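(* Let $\mathcal{A}$ be an independence algebra with universe $A$ and let $\mathcal{B}$ be a non-empty subalgebra of $\mathcal{A}$ with universe $B$. Assume $\mathcal{B}\neq\mathcal{A}$ and that either $\dim B\geq 2$, or $\langle\emptyset\rangle\neq\emptyset$ and $\dim B=1$. Let $T(\mathcal{A},\mathcal{B})$ be the semigroup of all endomorphisms of $\mathcal{A}$ whose image is contained in $B$, and let $\alpha,\beta\in T(\mathcal{A},\mathcal{B})$. Then $\alpha\,\mathcal{D}^*\,\beta$ in $T(\mathcal{A},\mathcal{B})$ if and only if one of the following happens: (I) $\mathrm{codim}_A B=1$ and $\rho(\alpha)=\rho(\beta)$; (II) $2\leq \mathrm{codim}_A B<\aleph_0$ and either ($e<\rho(\alpha)<\aleph_0$ and $e<\rho(\beta)<\aleph_0$) or $\rho(\alpha)=\rho(\beta)$; (III) $\mathrm{codim}_A B=\aleph_\kappa$ for some ordinal $\kappa$, and either ($e<\rho(\alpha)\leq\aleph_\kappa$ and $e<\rho(\beta)\leq\aleph_\kappa$) or $\rho(\alpha)=\rho(\beta)$.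
   Context: An algebra $\mathcal{A}=\langle A;F\rangle$ has a non-empty universe $A$ and a set $F$ of finitary operations. For $X\subseteq A$, $\langle X\rangle$ is the set of all $t(a_1,\dots,a_n)$ with $t$ a term operation and $a_i\in X$ (the subalgebra generated by $X$); $\langle\emptyset\rangle$ is the set of constants, i.e. values of nullary term operations (possibly empty). $X$ is independent if $x\notin\langle X\setminus\{x\}\rangle$ for all $x\in X$; a basis of a subalgebra is an independent generating set. Exchange property (EP): for all $X\subseteq A$ and $a,b\in A$, if $b\in\langle X\cup\{a\}\rangle$ and $b\notin\langle X\rangle$ then $a\in\langle X\cup\{b\}\rangle$. Under (EP) every subalgebra has a basis, all its bases have the same cardinality (its dimension, $\dim$), and independent sets extend to bases. Free basis property (F): every map from a basis of $\mathcal{A}$ to $A$ extends to an endomorphism of $\mathcal{A}$. An independence algebra is an algebra satisfying (EP) and (F). $\mathrm{codim}_A B$ is the cardinality of a set $Z$ such that $X\sqcup Z$ is a basis of $\mathcal{A}$, where $X$ is a basis of $\mathcal{B}$. Dimensions may be finite or infinite. Maps are written on the right and composed left to right. $\rho(\alpha)=\dim(A\alpha)$ is the rank of $\alpha$. $e=0$ if $\langle\emptyset\rangle\neq\emptyset$ and $e=1$ otherwise. For a semigroup $S$ and $a,b\in S$ ($S^1$ denotes $S$ with an identity adjoined if necessary): $a\,\mathcal{L}^*\,b$ iff for all $x,y\in S^1$, $ax=ay\Leftrightarrow bx=by$; $a\,\mathcal{R}^*\,b$ iff for all $x,y\in S^1$, $xa=ya\Leftrightarrow xb=yb$. $\mathcal{D}^*=\mathcal{L}^*\vee\mathcal{R}^*$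 is the join of these two equivalence relations (the smallest equivalence relation containing both). *)

theory Defs
  imports Main "HOL-Library.FuncSet"
begin

unbundle cardinal_syntax

section \<open>Algebras, term operations and generated subalgebras\<close>

text \<open>
  An algebra has a universe \<open>A\<close> and a set \<open>F\<close> of pairs \<open>(k, f)\<close>, where \<open>f\<close> is a \<open>k\<close>-ary operation,
  applied to argument lists of length \<open>k\<close>. The values of \<open>f\<close> on other lists play no role.
\<close>

type_synonym 'a operation = "nat \<times> ('a list \<Rightarrow> 'a)"

definition tuples :: "nat \<Rightarrow> 'a set \<Rightarrow> 'a list set" where
  "tuples k X = {xs. length xs = k \<and> set xs \<subseteq> X}"

locale univ_algebra =
  fixes A :: "'a set" and F :: "'a operation set"
  assumes nonempty: "A \<noteq> {}"
    and closed: "\<And>k f xs. (k, f) \<in> F \<Longrightarrow> xs \<in> tuples k A \<Longrightarrow> f xs \<in> A"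

text \<open>\<open>n\<close>-ary term operations; for \<open>n = 0\<close> there are no projections.\<close>

inductive term_op :: "'a operation set \<Rightarrow> nat \<Rightarrow> ('a list \<Rightarrow> 'a) \<Rightarrow> bool"
  for F :: "'a operation set" and n :: nat where
  proj: "i < n \<Longrightarrow> term_op F n (\<lambda>xs. xs ! i)"
| comp: "(k, f) \<in> F \<Longrightarrow> length ts = k \<Longrightarrow> (\<forall>t\<in>set ts. term_op F n t)
          \<Longrightarrow> term_op F n (\<lambda>xs. f (map (\<lambda>t. t xs) ts))"

definition gen :: "'a operation set \<Rightarrow> 'a set \<Rightarrow> 'a set" where
  "gen F X = {t xs | n t xs. term_op F n t \<and> xs \<in> tuples n X}"

definition subalgebra :: "'a set \<Rightarrow> 'a operation set \<Rightarrow> 'a set \<Rightarrow> bool" where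
  "subalgebra A F B \<longleftrightarrow> B \<subseteq> A \<and> (\<forall>(k, f)\<in>F. \<forall>xs\<in>tuples k B. f xs \<in> B)"

definition independent_set :: "'a operation set \<Rightarrow> 'a set \<Rightarrow> bool" where
  "independent_set F X \<longleftrightarrow> (\<forall>x\<in>X. x \<notin> gen F (X - {x}))"

definition basis_of :: "'a operation set \<Rightarrow> 'a set \<Rightarrow> 'a set \<Rightarrow> bool" where
  "basis_of F B X \<longleftrightarrow> X \<subseteq> B \<and> independent_set F X \<and> gen F X = B"

text \<open>
  Endomorphisms are taken extensional outside \<open>A\<close>, so that equality of HOL functions is equality
  of maps on \<open>A\<close>.
\<close>

definition endomorphisms :: "'a set \<Rightarrow> 'a operation set \<Rightarrow> ('a \<Rightarrow> 'a) set" where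
  "endomorphisms A F =
     {\<phi> \<in> A \<rightarrow>\<^sub>E A. \<forall>(k, f)\<in>F. \<forall>xs\<in>tuples k A. \<phi> (f xs) = f (map \<phi> xs)}"

locale independence_algebra = univ_algebra +
  assumes exchange: "\<And>X a b. X \<subseteq> A \<Longrightarrow> a \<in> A \<Longrightarrow> b \<in> A \<Longrightarrow>
      b \<in> gen F (insert a X) \<Longrightarrow> b \<notin> gen F X \<Longrightarrow> a \<in> gen F (insert b X)"
    and free_basis: "\<And>X g. basis_of F A X \<Longrightarrow> g \<in> X \<rightarrow> A \<Longrightarrow>
      \<exists>\<phi>\<in>endomorphisms A F. \<forall>x\<in>X. \<phi> x = g x"

section \<open>Dimension, codimension and rank\<close>

text \<open>
  Cardinals are the cardinal orders of the library, compared by \<open>=o\<close>, \<open>\<le>o\<close> and \<open><o\<close>; \<open>natLeq\<close> is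
  $\aleph_0$. Being $\aleph_\kappa$ for some ordinal $\kappa$ means being an infinite cardinal,
  that is \<open>natLeq \<le>o c\<close>. The choices below are immaterial up to \<open>=o\<close> in an independence algebra.
\<close>

definition alg_dim :: "'a operation set \<Rightarrow> 'a set \<Rightarrow> 'a rel" where
  "alg_dim F B = |SOME X. basis_of F B X|"

definition alg_codim :: "'a set \<Rightarrow> 'a operation set \<Rightarrow> 'a set \<Rightarrow> 'a rel" where
  "alg_codim A F B =
     |SOME Z. \<exists>X. basis_of F B X \<and> X \<inter> Z = {} \<and> basis_of F A (X \<union> Z)|"

definition alg_rank :: "'a set \<Rightarrow> 'a operation set \<Rightarrow> ('a \<Rightarrow> 'a) \<Rightarrow> 'a rel" where
  "alg_rank A F \<alpha> = alg_dim F (\<alpha> ` A)"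

definition fin_card :: "nat \<Rightarrow> nat rel" where
  "fin_card n = |{..<n}|"

text \<open>The number $e$: \<open>gen F {}\<close> is the set of constants.\<close>

definition const_defect :: "'a operation set \<Rightarrow> nat" where
  "const_defect F = (if gen F {} \<noteq> {} then 0 else 1)"

section \<open>The semigroup of endomorphisms with restricted range\<close>

definition restr_range_endos :: "'a set \<Rightarrow> 'a operation set \<Rightarrow> 'a set \<Rightarrow> ('a \<Rightarrow> 'a) set" where
  "restr_range_endos A F B = {\<alpha> \<in> endomorphisms A F. \<alpha> ` A \<subseteq> B}"

text \<open>Maps are composed from left to right.\<close>

definition endo_mult :: "'a set \<Rightarrow> ('a \<Rightarrow> 'a) \<Rightarrow> ('a \<Rightarrow> 'a) \<Rightarrow> ('a \<Rightarrow> 'a)" where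
  "endo_mult A \<alpha> \<beta> = compose A \<beta> \<alpha>"

section \<open>The relations $\mathcal{L}^*$, $\mathcal{R}^*$ and $\mathcal{D}^*$\<close>

text \<open>
  A semigroup has a carrier \<open>S\<close> and a multiplication \<open>m\<close>. The elements of $S^1$ have option type:
  \<open>Some x\<close> stands for \<open>x \<in> S\<close>, and \<open>None\<close> is the adjoined identity, present only
  if \<open>S\<close> has no identity of its own.
\<close>

definition has_identity :: "'s set \<Rightarrow> ('s \<Rightarrow> 's \<Rightarrow> 's) \<Rightarrow> bool" where
  "has_identity S m \<longleftrightarrow> (\<exists>u\<in>S. \<forall>x\<in>S. m u x = x \<and> m x u = x)"

definition monoid_ext :: "'s set \<Rightarrow> ('s \<Rightarrow> 's \<Rightarrow> 's) \<Rightarrow> 's option set" where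
  "monoid_ext S m = (if has_identity S m then Some ` S else insert None (Some ` S))"

fun mult_ext :: "('s \<Rightarrow> 's \<Rightarrow> 's) \<Rightarrow> 's option \<Rightarrow> 's option \<Rightarrow> 's option" where
  "mult_ext m None y = y"
| "mult_ext m (Some x) None = Some x"
| "mult_ext m (Some x) (Some y) = Some (m x y)"

definition L_star :: "'s set \<Rightarrow> ('s \<Rightarrow> 's \<Rightarrow> 's) \<Rightarrow> 's rel" where
  "L_star S m = {(a, b) \<in> S \<times> S. \<forall>x\<in>monoid_ext S m. \<forall>y\<in>monoid_ext S m.
     mult_ext m (Some a) x = mult_ext m (Some a) y \<longleftrightarrow>
     mult_ext m (Some b) x = mult_ext m (Some b) y}"

definition R_star :: "'s set \<Rightarrow> ('s \<Rightarrow> 's \<Rightarrow> 's) \<Rightarrow> 's rel" where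
  "R_star S m = {(a, b) \<in> S \<times> S. \<forall>x\<in>monoid_ext S m. \<forall>y\<in>monoid_ext S m.
     mult_ext m x (Some a) = mult_ext m y (Some a) \<longleftrightarrow>
     mult_ext m x (Some b) = mult_ext m y (Some b)}"

definition D_star :: "'s set \<Rightarrow> ('s \<Rightarrow> 's \<Rightarrow> 's) \<Rightarrow> 's rel" where
  "D_star S m = \<Inter> {r. equiv S r \<and> L_star S m \<union> R_star S m \<subseteq> r}"

end

theory Submission
  imports Defs
begin

text \<open>
  Since $B$ has two elements, $\alpha\,\mathcal{L}^*\,\beta$ holds
  exactly when the images are equal. If $\alpha\,\mathcal{R}^*\,\beta$ then either the kernels are
  equal on $A$, or the kernels agree on $B$ and neither $B\alpha = A\alpha$ nor
  $B\beta = A\beta$; both are sufficient. In the second case the ranks are $\mu + \nu$ and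
  $\mu + \nu'$ with $\mu$ the common dimension of $B\alpha$ and $B\beta$ and
  $1 \le \nu, \nu' \le \mathrm{codim}_A B$, so ranks can only change within the range
  described in (II) and (III). Conversely, equal ranks are linked through a map with the kernel of
  one and the image of the other. Collapsing $B$ onto a subalgebra of dimension $\mu \ge e$ and
  spreading a complement of $B$ over $\nu$ further basis elements realises any such $\mu$ and
  $\nu$, which brings every rank of the range down to $e + 1$.
\<close>

text \<open>Elements of the semigroup take values in B, so a pair of them can test a kernel only on
  B. What happens outside B is seen only by comparing some \<phi> with the identity of S^1, and
  \<phi>\<alpha> = \<alpha> is solvable exactly when B\<alpha> = A\<alpha>. This is the origin of
  the two cases for R* and of the freedom to change \<nu> in the second one. The number e is a lower
  bound for the dimension of a non-empty subalgebra, hence for \<mu>; since \<nu> is at least 1, the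
  smallest rank of the range is e + 1. A change of \<nu> is impossible in codimension 1, and it is
  absorbed when \<mu> is infinite and not below the codimension; in all other cases both sums lie in
  the range. In the converse direction \<nu> cannot exceed the codimension. If this is finite, a
  rank may be too large to reach e + 1 at once, so it is lowered repeatedly by passing from \<nu> =
  2 to \<nu> = 1, which needs only codimension at least 2. If it is infinite, the whole surplus over
  e is traded in one step.\<close>

subsection \<open>Cardinals\<close>

lemma finite_card_of_ordLeq: "finite A \<Longrightarrow> finite B \<Longrightarrow> |A| \<le>o |B| \<longleftrightarrow> card A \<le> card B"
  by (metis card_of_ordLeq inj_on_iff_card_le)

lemma finite_ordLess_infinite_card_of:
  assumes "finite A" "infinite B"
  shows "|A| <o |B|"
  using assms finite_ordLess_infinite[of "|A|" "|B|"] card_of_Well_order[of A] card_of_Well_order[of B]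
  by (simp add: Field_card_of)

lemma card_of_ordIso_fin_card: "|A| =o fin_card n \<longleftrightarrow> finite A \<and> card A = n"
proof
  assume *: "|A| =o fin_card n"
  then have "finite A" using card_of_ordIso_finite unfolding fin_card_def by blast
  with * show "finite A \<and> card A = n"
    using finite_card_of_ordLeq[of A "{..<n}"] finite_card_of_ordLeq[of "{..<n}" A]
    unfolding fin_card_def ordIso_iff_ordLeq by auto
next
  assume "finite A \<and> card A = n"
  then show "|A| =o fin_card n"
    using finite_card_of_ordLeq[of A "{..<n}"] finite_card_of_ordLeq[of "{..<n}" A]
    unfolding fin_card_def ordIso_iff_ordLeq by auto
qed

lemma fin_card_ordLeq_card_of: "fin_card n \<le>o |A| \<longleftrightarrow> infinite A \<or> n \<le> card A"
proof (cases "finite A")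
  case True
  then show ?thesis using finite_card_of_ordLeq[of "{..<n}" A] by (simp add: fin_card_def)
next
  case False
  then have "fin_card n <o |A|" unfolding fin_card_def by (simp add: finite_ordLess_infinite_card_of)
  with False show ?thesis using ordLess_imp_ordLeq by blast
qed

lemma fin_card_ordLess_card_of: "fin_card n <o |A| \<longleftrightarrow> infinite A \<or> n < card A"
proof (cases "finite A")
  case True
  then show ?thesis
    using finite_card_of_ordLeq[of A "{..<n}"] not_ordLeq_iff_ordLess[of "fin_card n" "|A|"]
      card_of_Well_order[of A] card_of_Well_order[of "{..<n}"]
    by (auto simp: fin_card_def)
next
  case False
  then show ?thesis unfolding fin_card_def by (simp add: finite_ordLess_infinite_card_of)
qed

lemma ordLeq_cong: "r =o r' \<Longrightarrow> s =o s' \<Longrightarrow> r \<le>o s \<longleftrightarrow> r' \<le>o s'"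
  by (meson ordIso_ordLeq_trans ordIso_symmetric ordLeq_ordIso_trans)

lemma ordLeq_cong_right: "s =o s' \<Longrightarrow> r \<le>o s \<longleftrightarrow> r \<le>o s'"
  by (meson ordIso_symmetric ordLeq_ordIso_trans)

lemma ordLess_cong_right: "s =o s' \<Longrightarrow> r <o s \<longleftrightarrow> r <o s'"
  by (meson ordIso_symmetric ordLess_ordIso_trans)

lemma ordLess_cong_left: "r =o r' \<Longrightarrow> r <o s \<longleftrightarrow> r' <o s"
  by (meson ordIso_ordLess_trans ordIso_symmetric)

lemma card_of_Un_disjoint:
  assumes "A \<inter> B = {}"
  shows "|A \<union> B| =o |A <+> B|"
proof -
  have "bij_betw (case_sum id id) (A <+> B) (A \<union> B)"
    using assms by (force simp: bij_betw_def inj_on_def image_iff)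
  then show ?thesis by (meson card_of_ordIsoI ordIso_symmetric)
qed

lemma card_of_image_inj: "inj_on f P \<Longrightarrow> |f ` P| =o |P|"
  by (meson card_of_ordIsoI inj_on_imp_bij_betw ordIso_symmetric)

subsection \<open>Finitary closure operators with exchange\<close>

text \<open>A matroid of finite character and arbitrary rank. It is kept abstract because it serves
  two closure operators: generation itself, and generation together with a fixed subalgebra, for the
  codimension.\<close>

locale finitary_exchange =
  fixes U :: "'a set" and cl :: "'a set \<Rightarrow> 'a set"
  assumes cl_carrier: "X \<subseteq> U \<Longrightarrow> cl X \<subseteq> U"
    and cl_extensive: "X \<subseteq> U \<Longrightarrow> X \<subseteq> cl X"
    and cl_least: "Y \<subseteq> U \<Longrightarrow> X \<subseteq> cl Y \<Longrightarrow> cl X \<subseteq> cl Y"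
    and cl_finitary: "X \<subseteq> U \<Longrightarrow> a \<in> cl X \<Longrightarrow> \<exists>Y\<subseteq>X. finite Y \<and> a \<in> cl Y"
    and cl_exchange: "X \<subseteq> U \<Longrightarrow> a \<in> U \<Longrightarrow> b \<in> cl (insert a X) \<Longrightarrow> b \<notin> cl X \<Longrightarrow> a \<in> cl (insert b X)"
begin

lemma cl_mono: "X \<subseteq> Y \<Longrightarrow> Y \<subseteq> U \<Longrightarrow> cl X \<subseteq> cl Y"
  by (meson cl_extensive cl_least subset_trans)

definition indep :: "'a set \<Rightarrow> bool" where
  "indep X \<longleftrightarrow> X \<subseteq> U \<and> (\<forall>x\<in>X. x \<notin> cl (X - {x}))"

lemma indep_subset:
  assumes "indep X" "Y \<subseteq> X"
  shows "indep Y"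
proof -
  have "cl (Y - {x}) \<subseteq> cl (X - {x})" for x
    by (rule cl_mono) (use assms in \<open>auto simp: indep_def\<close>)
  then show ?thesis
    using assms unfolding indep_def by blast
qed

text \<open>If some \<open>x\<close> in \<open>X\<close> became dependent on adding
  \<open>a\<close>, exchange would put \<open>a\<close> into the closure of
  \<open>X\<close>.\<close>

lemma indep_insert:
  assumes "indep X" "a \<in> U" "a \<notin> cl X"
  shows "indep (insert a X)"
  unfolding indep_def
proof (intro conjI ballI)
  show "insert a X \<subseteq> U" using assms by (auto simp: indep_def)
next
  fix x assume x: "x \<in> insert a X"
  have aX: "a \<notin> X"
    using assms cl_extensive[of X] by (auto simp: indep_def)
  show "x \<notin> cl (insert a X - {x})"
  proof (cases "x = a")
    case True
    with aX assms show ?thesis by simp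
  next
    case False
    with x have x: "x \<in> X" by simp
    show ?thesis
    proof
      assume "x \<in> cl (insert a X - {x})"
      moreover have "insert a X - {x} = insert a (X - {x})" using False by auto
      ultimately have "a \<in> cl (insert x (X - {x}))"
        using x assms cl_exchange[of "X - {x}" a x] by (auto simp: indep_def)
      with x assms show False by (simp add: insert_absorb)
    qed
  qed
qed

text \<open>Zorn's lemma for the independent sets between \<open>X\<close> and \<open>Y\<close>. A
  dependency in the union of a chain has a finite witness and so occurs in one member; a maximal set
  spans \<open>Y\<close>, because \<open>indep_insert\<close> would otherwise enlarge it.\<close>

lemma indep_extend:
  assumes "indep X" "X \<subseteq> Y" "Y \<subseteq> U"
  obtains W where "X \<subseteq> W" "W \<subseteq> Y" "indep W" "Y \<subseteq> cl W"
proof -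
  let ?Q = "{W. X \<subseteq> W \<and> W \<subseteq> Y \<and> indep W}"
  have "\<exists>M\<in>?Q. \<forall>W\<in>?Q. M \<subseteq> W \<longrightarrow> W = M"
  proof (rule subset_Zorn_nonempty)
    show "?Q \<noteq> {}" using assms by auto
  next
    fix C assume C: "C \<noteq> {}" "subset.chain ?Q C"
    then have CQ: "C \<subseteq> ?Q" by (auto simp: subset.chain_def)
    have "indep (\<Union>C)"
      unfolding indep_def
    proof (intro conjI ballI notI)
      show UC: "\<Union>C \<subseteq> U" using CQ assms by blast
      fix x assume x: "x \<in> \<Union>C" and "x \<in> cl (\<Union>C - {x})"
      then obtain K where K: "K \<subseteq> \<Union>C - {x}" "finite K" "x \<in> cl K"
        using cl_finitary[of "\<Union>C - {x}" x] UC by blast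
      obtain c where c: "c \<in> C" "insert x K \<subseteq> c"
        using finite_subset_Union_chain[of "insert x K" C ?Q] K x C by auto
      have c': "indep c" using c CQ by auto
      then have "cl K \<subseteq> cl (c - {x})"
        by (intro cl_mono) (use c K in \<open>auto simp: indep_def\<close>)
      with c' show False using K c by (auto simp: indep_def)
    qed
    moreover have "X \<subseteq> \<Union>C" "\<Union>C \<subseteq> Y" using C CQ by blast+
    ultimately show "\<Union>C \<in> ?Q" by blast
  qed
  then obtain W where WQ: "W \<in> ?Q" and max: "\<forall>V\<in>?Q. W \<subseteq> V \<longrightarrow> V = W" ..
  then have W: "X \<subseteq> W" "W \<subseteq> Y" "indep W" by simp_all
  have "Y \<subseteq> cl W"
  proof (rule ccontr)
    assume "\<not> Y \<subseteq> cl W"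
    then obtain a where a: "a \<in> Y" "a \<notin> cl W" by blast
    have "insert a W \<in> ?Q"
      using a W assms indep_insert[of W a] by blast
    then have "a \<in> W" using max by blast
    with a cl_extensive[of W] W assms show False by blast
  qed
  then show thesis by (rule that[OF W])
qed

text \<open>When the elements of \<open>T\<close> are added to \<open>I\<close> one at a time, some
  \<open>t\<close> is the first to bring \<open>a\<close> into the closure. With \<open>V\<close>
  the elements added before it, exchange trades \<open>t\<close> for \<open>a\<close>.\<close>

lemma exchange_step:
  assumes "finite T" "a \<notin> cl I" "a \<in> cl (I \<union> T)" "I \<union> T \<subseteq> U"
  shows "\<exists>t\<in>T. t \<in> cl (insert a (I \<union> (T - {t})))"
proof -
  have "\<exists>t\<in>T. \<exists>V\<subseteq>T - {t}. a \<notin> cl (I \<union> V) \<and> a \<in> cl (insert t (I \<union> V))"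
    using assms(1,3)
  proof (induction T)
    case empty
    with assms show ?case by simp
  next
    case (insert t T)
    show ?case
    proof (cases "a \<in> cl (I \<union> T)")
      case True
      with insert show ?thesis by blast
    next
      case False
      with insert show ?thesis by (intro bexI[of _ t] exI[of _ T]) auto
    qed
  qed
  then obtain t V where t: "t \<in> T" and V: "V \<subseteq> T - {t}" "a \<notin> cl (I \<union> V)" "a \<in> cl (insert t (I \<union> V))"
    by blast
  have aU: "a \<in> U" using assms(3) cl_carrier[OF assms(4)] by auto
  have "t \<in> cl (insert a (I \<union> V))"
    by (rule cl_exchange) (use t V assms(4) in auto)
  moreover have "cl (insert a (I \<union> V)) \<subseteq> cl (insert a (I \<union> (T - {t})))"
    by (rule cl_mono) (use V assms(4) aU in auto)
  ultimately show ?thesis using t by blast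
qed

text \<open>Each element of \<open>I\<close> that enters the spanning set drives out one element of
  \<open>S\<close>; \<open>T\<close> is what remains of \<open>S\<close>.\<close>

lemma steinitz:
  assumes "finite I" "indep I" "finite S" "S \<subseteq> U" "I \<subseteq> cl S"
  shows "\<exists>T\<subseteq>S. card T + card I = card S \<and> S \<subseteq> cl (I \<union> T)"
  using assms(1,2,5)
proof (induction I)
  case empty
  show ?case using cl_extensive[of S] assms by (intro exI[of _ S]) auto
next
  case (insert a I)
  have "indep I" using insert.prems(1) indep_subset by blast
  with insert obtain T where T: "T \<subseteq> S" "card T + card I = card S" "S \<subseteq> cl (I \<union> T)" by auto
  have IU: "insert a I \<union> T \<subseteq> U" using insert.prems T assms by (auto simp: indep_def)
  have fT: "finite T" using T assms finite_subset by blast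
  have "a \<notin> cl I" using insert.prems insert.hyps by (auto simp: indep_def)
  moreover have "a \<in> cl (I \<union> T)"
    using insert.prems cl_least[of "I \<union> T" S] T IU by auto
  ultimately obtain t where t: "t \<in> T" "t \<in> cl (insert a (I \<union> (T - {t})))"
    using exchange_step[of T a I] fT IU by auto
  have sub: "insert a I \<union> (T - {t}) \<subseteq> cl (insert a I \<union> (T - {t}))"
    by (rule cl_extensive) (use IU in auto)
  have "I \<union> T \<subseteq> cl (insert a I \<union> (T - {t}))" using t sub by auto
  then have "cl (I \<union> T) \<subseteq> cl (insert a I \<union> (T - {t}))"
    by (intro cl_least) (use IU in auto)
  with T have "S \<subseteq> cl (insert a I \<union> (T - {t}))" by blast
  moreover have "card (T - {t}) + card (insert a I) = card S"
    using T t fT insert.hyps card_Suc_Diff1[of T t] by simp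
  ultimately show ?case using T by (intro exI[of _ "T - {t}"]) auto
qed

text \<open>For finite \<open>S\<close> this is Steinitz replacement. For infinite \<open>S\<close>,
  each of its elements depends on a finite subset of \<open>I\<close>; these subsets cover
  \<open>I\<close>, since an omitted \<open>i\<close> would lie in the closure of the others, and
  their union is no larger than \<open>S\<close>.\<close>

lemma indep_ordLeq_spanning:
  assumes I: "indep I" and S: "S \<subseteq> U" and "I \<subseteq> cl S" "S \<subseteq> cl I"
  shows "|I| \<le>o |S|"
proof (cases "finite S")
  case True
  have le: "card J \<le> card S" if "finite J" "J \<subseteq> I" for J
    using steinitz[of J S] that indep_subset[of I J] assms True by fastforce
  have "finite I"
  proof (rule ccontr)
    assume "infinite I"
    then obtain J where "J \<subseteq> I" "finite J" "card J = Suc (card S)"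
      using infinite_arbitrarily_large by blast
    with le show False by fastforce
  qed
  with le[of I] True show ?thesis by (simp add: finite_card_of_ordLeq)
next
  case False
  have IU: "I \<subseteq> U" using I by (simp add: indep_def)
  have "\<forall>s\<in>S. \<exists>K\<subseteq>I. finite K \<and> s \<in> cl K"
    using cl_finitary[OF IU] assms by blast
  then obtain f where f: "\<And>s. s \<in> S \<Longrightarrow> f s \<subseteq> I \<and> finite (f s) \<and> s \<in> cl (f s)" by metis
  have "I \<subseteq> (\<Union>s\<in>S. f s)"
  proof (rule ccontr)
    assume "\<not> I \<subseteq> (\<Union>s\<in>S. f s)"
    then obtain i where i: "i \<in> I" "\<And>s. s \<in> S \<Longrightarrow> i \<notin> f s" by blast
    have "cl (f s) \<subseteq> cl (I - {i})" if "s \<in> S" for s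
      by (rule cl_mono) (use i f that IU in auto)
    then have "S \<subseteq> cl (I - {i})" using f by blast
    then have "cl S \<subseteq> cl (I - {i})" using IU by (intro cl_least) auto
    with i assms show False by (auto simp: indep_def)
  qed
  moreover have "|\<Union>s\<in>S. f s| \<le>o |S|"
    by (rule card_of_UNION_ordLeq_infinite)
      (use False f in \<open>auto intro: ordLess_imp_ordLeq finite_ordLess_infinite_card_of card_of_refl[THEN ordIso_imp_ordLeq]\<close>)
  ultimately show ?thesis by (meson card_of_mono1 ordLeq_transitive)
qed

lemma bases_ordIso:
  assumes "indep X" "indep Y" "X \<subseteq> cl Y" "Y \<subseteq> cl X"
  shows "|X| =o |Y|"
proof -
  have "X \<subseteq> U" "Y \<subseteq> U" using assms by (simp_all add: indep_def)
  then show ?thesis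
    using indep_ordLeq_spanning[of X Y] indep_ordLeq_spanning[of Y X] assms
    by (simp add: ordIso_iff_ordLeq)
qed

text \<open>Contraction of a matroid: exchange over \<open>X\<close> is the original exchange over
  \<open>D \<union> X\<close>.\<close>

lemma contraction:
  assumes "D \<subseteq> U"
  shows "finitary_exchange U (\<lambda>X. cl (D \<union> X))"
proof
  fix X assume "X \<subseteq> U"
  with assms show "cl (D \<union> X) \<subseteq> U" "X \<subseteq> cl (D \<union> X)"
    using cl_carrier[of "D \<union> X"] cl_extensive[of "D \<union> X"] by auto
next
  fix X Y assume "Y \<subseteq> U" "X \<subseteq> cl (D \<union> Y)"
  with assms show "cl (D \<union> X) \<subseteq> cl (D \<union> Y)"
    using cl_extensive[of "D \<union> Y"] by (intro cl_least) auto
next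
  fix X a assume X: "X \<subseteq> U" "a \<in> cl (D \<union> X)"
  then obtain Y where Y: "Y \<subseteq> D \<union> X" "finite Y" "a \<in> cl Y"
    using cl_finitary[of "D \<union> X" a] assms by auto
  have "cl Y \<subseteq> cl (D \<union> (Y \<inter> X))" by (rule cl_mono) (use X Y assms in auto)
  with Y show "\<exists>Y\<subseteq>X. finite Y \<and> a \<in> cl (D \<union> Y)" by (intro exI[of _ "Y \<inter> X"]) auto
next
  fix X a b assume "X \<subseteq> U" "a \<in> U" "b \<in> cl (D \<union> insert a X)" "b \<notin> cl (D \<union> X)"
  with assms show "a \<in> cl (D \<union> insert b X)"
    using cl_exchange[of "D \<union> X" a b] by simp
qed

end

subsection \<open>Generated subalgebras and endomorphisms\<close>

text \<open>An inductive form of \<open>gen\<close>, identified with it in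
  \<open>gen_eq_hull\<close>. It offers rule induction without substituting terms of different
  arities into each other.\<close>

inductive_set gen_hull :: "'a operation set \<Rightarrow> 'a set \<Rightarrow> 'a set"
  for F :: "'a operation set" and X :: "'a set" where
  base: "x \<in> X \<Longrightarrow> x \<in> gen_hull F X"
| step: "(k, f) \<in> F \<Longrightarrow> length xs = k \<Longrightarrow> \<forall>x\<in>set xs. x \<in> gen_hull F X \<Longrightarrow> f xs \<in> gen_hull F X"

lemma gen_hull_mono:
  assumes "X \<subseteq> Y"
  shows "gen_hull F X \<subseteq> gen_hull F Y"
proof
  fix a assume "a \<in> gen_hull F X"
  then show "a \<in> gen_hull F Y"
    by induction (use assms in \<open>auto intro: gen_hull.intros\<close>)
qed

text \<open>The finite support is a list, so that it can serve as the common argument list of the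
  terms built next.\<close>

lemma gen_hull_finitary:
  assumes "a \<in> gen_hull F X"
  shows "\<exists>ys. set ys \<subseteq> X \<and> a \<in> gen_hull F (set ys)"
  using assms
proof induction
  case (base x)
  then show ?case by (intro exI[of _ "[x]"]) (auto intro: gen_hull.base)
next
  case (step k f xs)
  then obtain h where h: "\<And>x. x \<in> set xs \<Longrightarrow> set (h x) \<subseteq> X \<and> x \<in> gen_hull F (set (h x))" by metis
  let ?ys = "concat (map h xs)"
  have "x \<in> gen_hull F (set ?ys)" if "x \<in> set xs" for x
    using h[OF that] gen_hull_mono[of "set (h x)" "set ?ys"] that by auto
  then have "f xs \<in> gen_hull F (set ?ys)" using step by (intro gen_hull.step) auto
  moreover have "set ?ys \<subseteq> X" using h by auto
  ultimately show ?case by blast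
qed

text \<open>Terms in a common list of arguments can be composed without renaming variables, so the
  values of all terms at one fixed list form a subalgebra.\<close>

lemma gen_hull_set_term_op:
  assumes "a \<in> gen_hull F (set ys)"
  shows "\<exists>t. term_op F (length ys) t \<and> a = t ys"
  using assms
proof induction
  case (base x)
  then show ?case by (metis in_set_conv_nth term_op.proj)
next
  case (step k f xs)
  then obtain h where h: "\<And>x. x \<in> set xs \<Longrightarrow> term_op F (length ys) (h x) \<and> x = h x ys" by metis
  have "term_op F (length ys) (\<lambda>zs. f (map (\<lambda>t. t zs) (map h xs)))"
    using step h by (intro term_op.comp) auto
  moreover have "map (\<lambda>t. t ys) (map h xs) = xs"
    using h by (auto intro: map_idI)
  ultimately show ?case
    by (intro exI[of _ "\<lambda>zs. f (map (\<lambda>t. t zs) (map h xs))"]) simp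
qed

lemma term_op_in_hull:
  assumes "term_op F n t" "length ys = n" "set ys \<subseteq> X"
  shows "t ys \<in> gen_hull F X"
  using assms
proof induction
  case (proj i)
  then show ?case by (meson gen_hull.base nth_mem subsetD)
next
  case (comp k f ts)
  then show ?case by (intro gen_hull.step) auto
qed

lemma gen_eq_hull: "gen F X = gen_hull F X"
proof
  show "gen F X \<subseteq> gen_hull F X"
    by (auto simp: gen_def tuples_def intro: term_op_in_hull)
  show "gen_hull F X \<subseteq> gen F X"
  proof
    fix a assume "a \<in> gen_hull F X"
    then obtain ys where "set ys \<subseteq> X" "a \<in> gen_hull F (set ys)"
      using gen_hull_finitary[of a F X] by blast
    then show "a \<in> gen F X"
      using gen_hull_set_term_op[of a F ys] by (auto simp: gen_def tuples_def)
  qed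
qed

lemma gen_superset: "X \<subseteq> gen F X"
  by (auto simp: gen_eq_hull intro: gen_hull.base)

lemma gen_mono: "X \<subseteq> Y \<Longrightarrow> gen F X \<subseteq> gen F Y"
  by (simp add: gen_eq_hull gen_hull_mono)

lemma gen_op: "(k, f) \<in> F \<Longrightarrow> xs \<in> tuples k (gen F X) \<Longrightarrow> f xs \<in> gen F X"
  unfolding gen_eq_hull tuples_def by (rule gen_hull.step[of k]) auto

lemma gen_subset_closed:
  assumes "X \<subseteq> C" "\<And>k f xs. (k, f) \<in> F \<Longrightarrow> xs \<in> tuples k C \<Longrightarrow> f xs \<in> C"
  shows "gen F X \<subseteq> C"
proof
  fix a assume "a \<in> gen F X"
  then have "a \<in> gen_hull F X" by (simp add: gen_eq_hull)
  then show "a \<in> C"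
  proof induction
    case (base x)
    then show ?case using assms(1) by blast
  next
    case (step k f xs)
    then show ?case using assms(2)[of k f xs] by (auto simp: tuples_def)
  qed
qed

lemma gen_least: "X \<subseteq> gen F Y \<Longrightarrow> gen F X \<subseteq> gen F Y"
  by (rule gen_subset_closed) (simp, rule gen_op)

lemma gen_subalgebra: "subalgebra A F C \<Longrightarrow> gen F C = C"
  using gen_subset_closed[of C C F] gen_superset[of C F] by (fastforce simp: subalgebra_def)

lemma gen_finitary: "a \<in> gen F X \<Longrightarrow> \<exists>Y\<subseteq>X. finite Y \<and> a \<in> gen F Y"
  unfolding gen_eq_hull using gen_hull_finitary[of a F X] by (metis List.finite_set)

lemma basis_of_subset: "basis_of F C X \<Longrightarrow> X \<subseteq> C"
  by (simp add: basis_of_def)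

lemma basis_of_gen: "basis_of F C X \<Longrightarrow> gen F X = C"
  by (simp add: basis_of_def)

lemma gen_eqI: "X \<subseteq> gen F Y \<Longrightarrow> Y \<subseteq> gen F X \<Longrightarrow> gen F X = gen F Y"
  using gen_least by blast

text \<open>Without constants the hypothesis is \<open>1 \<le> card X\<close>, which excludes the
  empty set; with constants every generated set contains them.\<close>

lemma gen_nonempty:
  assumes "const_defect F \<le> card X"
  shows "gen F X \<noteq> {}"
proof (cases "gen F {} = {}")
  case True
  then have "X \<noteq> {}" using assms by (auto simp: const_defect_def)
  then show ?thesis using gen_superset[of X F] by blast
next
  case False
  then show ?thesis using gen_mono[of "{}" X F] by blast
qed

definition same_kernel :: "'a set \<Rightarrow> ('a \<Rightarrow> 'a) \<Rightarrow> ('a \<Rightarrow> 'a) \<Rightarrow> bool" where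
  "same_kernel C \<phi> \<psi> \<longleftrightarrow> (\<forall>a\<in>C. \<forall>b\<in>C. \<phi> a = \<phi> b \<longleftrightarrow> \<psi> a = \<psi> b)"

lemma same_kernel_sym: "same_kernel C \<phi> \<psi> \<Longrightarrow> same_kernel C \<psi> \<phi>"
  by (auto simp: same_kernel_def)

context univ_algebra
begin

lemma subalgebra_UNIV: "subalgebra A F A"
  using closed by (auto simp: subalgebra_def)

lemma gen_carrier: "X \<subseteq> A \<Longrightarrow> gen F X \<subseteq> A"
  by (rule gen_subset_closed) (auto intro: closed)

lemma subalgebra_gen: "X \<subseteq> A \<Longrightarrow> subalgebra A F (gen F X)"
  using gen_carrier gen_op by (fastforce simp: subalgebra_def)

lemma endo_in: "\<phi> \<in> endomorphisms A F \<Longrightarrow> a \<in> A \<Longrightarrow> \<phi> a \<in> A"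
  by (auto simp: endomorphisms_def)

lemma endo_image_carrier: "\<phi> \<in> endomorphisms A F \<Longrightarrow> X \<subseteq> A \<Longrightarrow> \<phi> ` X \<subseteq> A"
  by (auto simp: endo_in)

lemma endo_op:
  "\<phi> \<in> endomorphisms A F \<Longrightarrow> (k, f) \<in> F \<Longrightarrow> xs \<in> tuples k A \<Longrightarrow> \<phi> (f xs) = f (map \<phi> xs)"
  by (auto simp: endomorphisms_def)

lemma endo_gen:
  assumes \<phi>: "\<phi> \<in> endomorphisms A F" and X: "X \<subseteq> A"
  shows "\<phi> ` gen F X = gen F (\<phi> ` X)"
proof
  have "gen F X \<subseteq> {a \<in> A. \<phi> a \<in> gen F (\<phi> ` X)}"
  proof (rule gen_subset_closed)
    show "X \<subseteq> {a \<in> A. \<phi> a \<in> gen F (\<phi> ` X)}" using X gen_superset[of "\<phi> ` X" F] by auto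
  next
    fix k f xs assume kf: "(k, f) \<in> F" and xs: "xs \<in> tuples k {a \<in> A. \<phi> a \<in> gen F (\<phi> ` X)}"
    then have "xs \<in> tuples k A" "map \<phi> xs \<in> tuples k (gen F (\<phi> ` X))" by (auto simp: tuples_def)
    with kf show "f xs \<in> {a \<in> A. \<phi> a \<in> gen F (\<phi> ` X)}"
      using closed endo_op[OF \<phi> kf] gen_op[OF kf, of "map \<phi> xs" "\<phi> ` X"] by auto
  qed
  then show "\<phi> ` gen F X \<subseteq> gen F (\<phi> ` X)" by auto
  show "gen F (\<phi> ` X) \<subseteq> \<phi> ` gen F X"
  proof (rule gen_subset_closed)
    show "\<phi> ` X \<subseteq> \<phi> ` gen F X" using gen_superset[of X F] by auto
  next
    fix k f xs assume kf: "(k, f) \<in> F" and xs: "xs \<in> tuples k (\<phi> ` gen F X)"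
    \<comment> \<open>Passing to lists allows preimages of all arguments to be chosen at
      once.\<close>
    then have "xs \<in> lists (\<phi> ` gen F X)" by (auto simp: tuples_def)
    then obtain ys where ys: "ys \<in> lists (gen F X)" "xs = map \<phi> ys"
      by (auto simp: lists_image)
    with xs have "ys \<in> tuples k (gen F X)" by (auto simp: tuples_def)
    moreover from this have "ys \<in> tuples k A" using gen_carrier[OF X] by (auto simp: tuples_def)
    ultimately show "f xs \<in> \<phi> ` gen F X"
      using endo_op[OF \<phi> kf] ys gen_op[OF kf, of ys X] by (metis imageI)
  qed
qed

text \<open>The points at which two endomorphisms agree form a subalgebra.\<close>

lemma endo_eq_on_gen:
  assumes \<phi>: "\<phi> \<in> endomorphisms A F" and \<psi>: "\<psi> \<in> endomorphisms A F" and X: "X \<subseteq> A"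
    and eq: "\<And>x. x \<in> X \<Longrightarrow> \<phi> x = \<psi> x" and a: "a \<in> gen F X"
  shows "\<phi> a = \<psi> a"
proof -
  have "gen F X \<subseteq> {a \<in> A. \<phi> a = \<psi> a}"
  proof (rule gen_subset_closed)
    show "X \<subseteq> {a \<in> A. \<phi> a = \<psi> a}" using X eq by auto
  next
    fix k f xs assume kf: "(k, f) \<in> F" and xs: "xs \<in> tuples k {a \<in> A. \<phi> a = \<psi> a}"
    then have "xs \<in> tuples k A" "map \<phi> xs = map \<psi> xs" by (auto simp: tuples_def)
    with kf show "f xs \<in> {a \<in> A. \<phi> a = \<psi> a}"
      using closed[OF kf] endo_op[OF \<phi> kf] endo_op[OF \<psi> kf] by (simp del: map_eq_conv)
  qed
  with a show ?thesis by auto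
qed

lemma endo_eqI:
  assumes "\<phi> \<in> endomorphisms A F" "\<psi> \<in> endomorphisms A F" "\<And>a. a \<in> A \<Longrightarrow> \<phi> a = \<psi> a"
  shows "\<phi> = \<psi>"
  by (rule PiE_ext[of _ A "\<lambda>_. A"]) (use assms in \<open>auto simp: endomorphisms_def\<close>)

lemma endo_mult_endo:
  assumes "\<phi> \<in> endomorphisms A F" "\<psi> \<in> endomorphisms A F"
  shows "endo_mult A \<phi> \<psi> \<in> endomorphisms A F"
proof -
  have "compose A \<psi> \<phi> (f xs) = f (map (compose A \<psi> \<phi>) xs)"
    if kf: "(k, f) \<in> F" and xs: "xs \<in> tuples k A" for k f xs
  proof -
    have m: "map \<phi> xs \<in> tuples k A" using xs assms(1) by (auto simp: tuples_def endo_in)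
    have "map (compose A \<psi> \<phi>) xs = map \<psi> (map \<phi> xs)"
      using xs by (auto simp: tuples_def compose_def)
    with m show ?thesis
      using endo_op[OF assms(1) kf xs] endo_op[OF assms(2) kf m] closed[OF kf xs]
      by (simp add: compose_def del: map_eq_conv)
  qed
  moreover have "compose A \<psi> \<phi> \<in> A \<rightarrow>\<^sub>E A"
    using assms by (auto simp: compose_def endo_in)
  ultimately show ?thesis
    unfolding endo_mult_def endomorphisms_def by blast
qed

lemma endo_image_subalgebra:
  assumes "\<phi> \<in> endomorphisms A F" "subalgebra A F C"
  shows "subalgebra A F (\<phi> ` C)"
proof -
  have C: "C \<subseteq> A" using assms by (simp add: subalgebra_def)
  have "\<phi> ` C = gen F (\<phi> ` C)"
    using endo_gen[OF assms(1) C] gen_subalgebra[OF assms(2)] by simp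
  then show ?thesis
    using subalgebra_gen[of "\<phi> ` C"] endo_image_carrier[OF assms(1) C] by simp
qed

lemma id_endo: "(\<lambda>x\<in>A. x) \<in> endomorphisms A F"
proof -
  have "map (\<lambda>x\<in>A. x) xs = xs" if "xs \<in> tuples k A" for k xs
    using that by (auto simp: tuples_def intro!: map_idI)
  then show ?thesis using closed by (fastforce simp: endomorphisms_def)
qed

end

subsection \<open>Bases, dimension and codimension\<close>

context independence_algebra
begin

sublocale gen: finitary_exchange A "gen F"
proof
  show "gen F X \<subseteq> A" if "X \<subseteq> A" for X using gen_carrier[OF that] .
  show "X \<subseteq> gen F X" for X by (rule gen_superset)
  show "gen F X \<subseteq> gen F Y" if "X \<subseteq> gen F Y" for X Y using gen_least[OF that] .
  show "\<exists>Y\<subseteq>X. finite Y \<and> a \<in> gen F Y" if "a \<in> gen F X" for X a using gen_finitary[OF that] .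
  show "a \<in> gen F (insert b X)"
    if "X \<subseteq> A" "a \<in> A" "b \<in> gen F (insert a X)" "b \<notin> gen F X" for X a b
    using exchange[of X a b] gen_carrier[of "insert a X"] that by auto
qed

lemma basis_of_iff: "C \<subseteq> A \<Longrightarrow> basis_of F C X \<longleftrightarrow> X \<subseteq> C \<and> gen.indep X \<and> gen F X = C"
  by (auto simp: basis_of_def gen.indep_def independent_set_def)

lemma subalgebra_carrier: "subalgebra A F C \<Longrightarrow> C \<subseteq> A"
  by (simp add: subalgebra_def)

lemma basis_extend:
  assumes C: "subalgebra A F C" and Y: "gen.indep Y" "Y \<subseteq> C"
  obtains X where "Y \<subseteq> X" "basis_of F C X"
proof -
  have CA: "C \<subseteq> A" using C by (rule subalgebra_carrier)
  obtain X where X: "Y \<subseteq> X" "X \<subseteq> C" "gen.indep X" "C \<subseteq> gen F X"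
    using gen.indep_extend[OF Y CA] .
  have "gen F X \<subseteq> C" using gen_mono[OF X(2), of F] gen_subalgebra[OF C] by simp
  with X CA have "basis_of F C X" by (simp add: basis_of_iff)
  with X that show thesis by blast
qed

lemma indep_empty: "gen.indep {}"
  by (simp add: gen.indep_def)

lemma basis_exists:
  assumes "subalgebra A F C"
  obtains X where "basis_of F C X"
  using basis_extend[OF assms indep_empty] by blast

lemma basis_of_ordIso:
  assumes "C \<subseteq> A" "basis_of F C X" "basis_of F C Y"
  shows "|X| =o |Y|"
  using assms by (intro gen.bases_ordIso) (auto simp: basis_of_iff)

lemma alg_dim_basis:
  assumes C: "subalgebra A F C" and X: "basis_of F C X"
  shows "alg_dim F C =o |X|"
  unfolding alg_dim_def
  by (rule basis_of_ordIso[OF subalgebra_carrier[OF C] someI[of "basis_of F C", OF X] X])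

lemma alg_rank_basis:
  assumes "\<phi> \<in> endomorphisms A F" "basis_of F (\<phi> ` A) X"
  shows "alg_rank A F \<phi> =o |X|"
  unfolding alg_rank_def
  by (rule alg_dim_basis[OF endo_image_subalgebra[OF assms(1) subalgebra_UNIV] assms(2)])

text \<open>Complements of a basis of \<open>C\<close> are the bases of the closure operator contracted by \<open>C\<close>; this
  gives their equicardinality also for infinite dimensions, where cardinals do not cancel.\<close>

lemma complements_ordIso:
  assumes C: "subalgebra A F C"
    and X: "basis_of F C X" "X \<inter> Z = {}" "basis_of F A (X \<union> Z)"
    and X': "basis_of F C X'" "X' \<inter> Z' = {}" "basis_of F A (X' \<union> Z')"
  shows "|Z| =o |Z'|"
proof -
  have CA: "C \<subseteq> A" using C by (rule subalgebra_carrier)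
  interpret contr: finitary_exchange A "\<lambda>X. gen F (C \<union> X)"
    using gen.contraction[OF CA] .
  \<comment> \<open>Since \<open>Y\<close> generates \<open>C\<close>, a dependency of
    \<open>V\<close> over \<open>C\<close> is a dependency inside the basis
    \<open>Y \<union> V\<close> of \<open>A\<close>.\<close>
  have ind: "contr.indep V"
    if V: "basis_of F C Y" "Y \<inter> V = {}" "basis_of F A (Y \<union> V)" for Y V
    unfolding contr.indep_def
  proof (intro conjI ballI notI)
    show "V \<subseteq> A" using basis_of_subset[OF V(3)] by simp
    fix v assume v: "v \<in> V" "v \<in> gen F (C \<union> (V - {v}))"
    have "C \<union> (V - {v}) \<subseteq> gen F (Y \<union> (V - {v}))"
      using gen_mono[of Y "Y \<union> (V - {v})" F] gen_superset[of "Y \<union> (V - {v})" F] basis_of_gen[OF V(1)]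
      by auto
    then have "v \<in> gen F (Y \<union> (V - {v}))" using v(2) gen_least by blast
    moreover have "Y \<union> (V - {v}) = Y \<union> V - {v}" using v V(2) by auto
    ultimately show False using V(3) v(1) by (auto simp: basis_of_def independent_set_def)
  qed
  have span: "A \<subseteq> gen F (C \<union> V)" if V: "basis_of F C Y" "basis_of F A (Y \<union> V)" for Y V
    using gen_mono[of "Y \<union> V" "C \<union> V" F] basis_of_gen[OF V(2)] basis_of_subset[OF V(1)] by auto
  have "Z \<subseteq> A" "Z' \<subseteq> A" using basis_of_subset[OF X(3)] basis_of_subset[OF X'(3)] by auto
  then show ?thesis
    using contr.bases_ordIso[OF ind[OF X] ind[OF X']] span[OF X(1,3)] span[OF X'(1,3)] by auto
qed

lemma alg_codim_complement:
  assumes C: "subalgebra A F C"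
    and X: "basis_of F C X" "X \<inter> Z = {}" "basis_of F A (X \<union> Z)"
  shows "alg_codim A F C =o |Z|"
proof -
  let ?P = "\<lambda>Z. \<exists>X. basis_of F C X \<and> X \<inter> Z = {} \<and> basis_of F A (X \<union> Z)"
  have "?P (SOME Z. ?P Z)" by (rule someI[of ?P Z]) (use X in blast)
  then obtain X' where "basis_of F C X'" "X' \<inter> (SOME Z. ?P Z) = {}" "basis_of F A (X' \<union> (SOME Z. ?P Z))"
    by blast
  then show ?thesis
    unfolding alg_codim_def using complements_ordIso[OF C] X by blast
qed

lemma complement_exists:
  assumes C: "subalgebra A F C" and X: "basis_of F C X"
  obtains Z where "X \<inter> Z = {}" "basis_of F A (X \<union> Z)"
proof -
  have CA: "C \<subseteq> A" using C by (rule subalgebra_carrier)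
  have "gen.indep X" "X \<subseteq> A" using X CA by (auto simp: basis_of_iff)
  then obtain V where V: "X \<subseteq> V" "basis_of F A V" using basis_extend[OF subalgebra_UNIV] by blast
  then have "X \<union> (V - X) = V" by auto
  with V that[of "V - X"] show thesis by auto
qed

text \<open>Equal kernels on \<open>C\<close> make \<phi> c \<mapsto> \<psi> c an isomorphism of the
  two images, which carries bases to bases. The argument stays with preimages, so that one set
  \<open>P\<close> measures both dimensions.\<close>

lemma common_transversal:
  assumes C: "subalgebra A F C" and \<phi>: "\<phi> \<in> endomorphisms A F" and \<psi>: "\<psi> \<in> endomorphisms A F"
    and ker: "same_kernel C \<phi> \<psi>"
  obtains P where "P \<subseteq> C" "inj_on \<phi> P" "inj_on \<psi> P"
    "basis_of F (\<phi> ` C) (\<phi> ` P)" "basis_of F (\<psi> ` C) (\<psi> ` P)"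
proof -
  have CA: "C \<subseteq> A" using C by (rule subalgebra_carrier)
  obtain Y where Y: "basis_of F (\<phi> ` C) Y" using basis_exists[OF endo_image_subalgebra[OF \<phi> C]] .
  define P where "P = inv_into C \<phi> ` Y"
  have YC: "Y \<subseteq> \<phi> ` C" using Y by (rule basis_of_subset)
  have PC: "P \<subseteq> C" using YC inv_into_into[of _ \<phi> C] by (auto simp: P_def)
  have PY: "\<phi> ` P = Y" using YC f_inv_into_f[of _ \<phi> C] by (force simp: P_def)
  have inj: "inj_on \<phi> P"
    using YC f_inv_into_f[of _ \<phi> C] by (auto simp: P_def inj_on_def subset_eq)
  have inj': "inj_on \<psi> P"
    using inj ker PC unfolding inj_on_def same_kernel_def by blast
  have PA: "P \<subseteq> A" using PC CA by simp
  \<comment> \<open>Keeps everything generated by part of \<open>P\<close> inside \<open>C\<close>,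
    where the kernels can be compared.\<close>
  have gC: "gen F V \<subseteq> C" if "V \<subseteq> P" for V
    using gen_mono[of V C F] that PC gen_subalgebra[OF C] by auto
  have "independent_set F (\<psi> ` P)"
    unfolding independent_set_def
  proof (intro ballI notI)
    fix q assume "q \<in> \<psi> ` P" and q: "q \<in> gen F (\<psi> ` P - {q})"
    then obtain p where p: "p \<in> P" "q = \<psi> p" by blast
    have "\<psi> ` P - {q} = \<psi> ` (P - {p})" using inj' p by (auto simp: inj_on_def)
    moreover have sub: "P - {p} \<subseteq> A" using PA by auto
    ultimately have "q \<in> \<psi> ` gen F (P - {p})" using q endo_gen[OF \<psi> sub] by simp
    \<comment> \<open>The relation \<psi> p = \<psi> r transfers to \<phi>, where it contradicts the
      independence of \<open>Y\<close>.\<close>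
    then obtain r where r: "r \<in> gen F (P - {p})" "q = \<psi> r" by blast
    have "r \<in> C" using gC[of "P - {p}"] r by auto
    then have "\<phi> p = \<phi> r" using ker r p PC by (auto simp: same_kernel_def subset_eq)
    then have "\<phi> p \<in> gen F (\<phi> ` (P - {p}))" using r endo_gen[OF \<phi> sub] by auto
    moreover have "\<phi> ` (P - {p}) = Y - {\<phi> p}" using inj p PY by (auto simp: inj_on_def)
    ultimately show False using Y p PY by (auto simp: basis_of_def independent_set_def)
  qed
  moreover have "\<psi> ` C \<subseteq> gen F (\<psi> ` P)"
  proof
    fix b assume "b \<in> \<psi> ` C"
    then obtain c where c: "c \<in> C" "b = \<psi> c" by blast
    have "\<phi> c \<in> \<phi> ` gen F P" using c basis_of_gen[OF Y] endo_gen[OF \<phi> PA] PY by auto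
    then obtain r where r: "r \<in> gen F P" "\<phi> c = \<phi> r" by blast
    then have "\<psi> c = \<psi> r" using gC[of P] ker c by (auto simp: same_kernel_def)
    with r c show "b \<in> gen F (\<psi> ` P)" using endo_gen[OF \<psi> PA] by auto
  qed
  moreover have "gen F (\<psi> ` P) \<subseteq> \<psi> ` C" using endo_gen[OF \<psi> PA] gC[of P] by auto
  ultimately have "basis_of F (\<psi> ` C) (\<psi> ` P)" using PC by (auto simp: basis_of_def)
  with that PC inj inj' Y PY show thesis by blast
qed

lemma rank_eq_of_same_kernel:
  assumes "\<phi> \<in> endomorphisms A F" "\<psi> \<in> endomorphisms A F" "same_kernel A \<phi> \<psi>"
  shows "alg_rank A F \<phi> =o alg_rank A F \<psi>"
proof -
  obtain P where P: "inj_on \<phi> P" "inj_on \<psi> P"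
    "basis_of F (\<phi> ` A) (\<phi> ` P)" "basis_of F (\<psi> ` A) (\<psi> ` P)"
    using common_transversal[OF subalgebra_UNIV assms] by blast
  have "alg_rank A F \<phi> =o |P|" "alg_rank A F \<psi> =o |P|"
    using alg_rank_basis P assms card_of_image_inj ordIso_transitive by blast+
  then show ?thesis using ordIso_transitive ordIso_symmetric by blast
qed

text \<open>The dimension hypothesis enters the proof only through this consequence. The two
  elements are two basis elements, or a basis element and a constant, which differ because no
  element of an independent set is a constant.\<close>

lemma two_elements:
  assumes B: "subalgebra A F B"
    and dim: "fin_card 2 \<le>o alg_dim F B \<or> (gen F {} \<noteq> {} \<and> alg_dim F B =o fin_card 1)"
  shows "\<exists>b\<in>B. \<exists>b'\<in>B. b \<noteq> b'"
proof -
  obtain X where X: "basis_of F B X" using basis_exists[OF B] .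
  have XB: "X \<subseteq> B" using X by (rule basis_of_subset)
  have dimX: "alg_dim F B =o |X|" by (rule alg_dim_basis[OF B X])
  from dim show ?thesis
  proof
    assume "fin_card 2 \<le>o alg_dim F B"
    then have "infinite X \<or> 2 \<le> card X"
      using ordLeq_cong_right[OF dimX] fin_card_ordLeq_card_of by blast
    then have "\<not> (\<exists>x. X \<subseteq> {x})"
      using card_mono[of "{x}" X for x] finite_subset by fastforce
    then show ?thesis using XB by blast
  next
    assume *: "gen F {} \<noteq> {} \<and> alg_dim F B =o fin_card 1"
    then obtain c where c: "c \<in> gen F {}" by blast
    have "|X| =o fin_card 1" using * dimX by (meson ordIso_symmetric ordIso_transitive)
    then have "card X = 1" by (simp add: card_of_ordIso_fin_card)
    then obtain x where x: "x \<in> X" by fastforce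
    have "x \<notin> gen F {}"
      using X x gen_mono[of "{}" "X - {x}" F] by (auto simp: basis_of_def independent_set_def)
    with c have "c \<noteq> x" by blast
    moreover have "c \<in> B" using c gen_mono[of "{}" B F] gen_subalgebra[OF B] by auto
    ultimately show ?thesis using x XB by blast
  qed
qed

end

subsection \<open>The relations $\mathcal{L}^*$ and $\mathcal{R}^*$\<close>

text \<open>Gives both kinds of elements of the extended semigroup a pointwise action, so that
  equations between products become equations between values.\<close>

definition act :: "('a \<Rightarrow> 'a) option \<Rightarrow> 'a \<Rightarrow> 'a" where
  "act x = (case x of None \<Rightarrow> id | Some \<phi> \<Rightarrow> \<phi>)"

lemma act_simps [simp]: "act None = id" "act (Some \<phi>) = \<phi>"
  by (simp_all add: act_def)

locale restricted_range = independence_algebra A F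
  for A :: "'a set" and F :: "'a operation set" +
  fixes B :: "'a set"
  assumes subalgebra_B: "subalgebra A F B"
    and B_nonempty: "B \<noteq> {}"
    and B_proper: "B \<noteq> A"
    and B_two: "\<exists>b\<in>B. \<exists>b'\<in>B. b \<noteq> b'"
begin

abbreviation "S \<equiv> restr_range_endos A F B"
abbreviation "S1 \<equiv> monoid_ext S (endo_mult A)"
abbreviation "Ls \<equiv> L_star S (endo_mult A)"
abbreviation "Rs \<equiv> R_star S (endo_mult A)"
abbreviation "rk \<equiv> alg_rank A F"

lemma BA: "B \<subseteq> A"
  using subalgebra_B by (rule subalgebra_carrier)

lemma S_endo: "\<phi> \<in> S \<Longrightarrow> \<phi> \<in> endomorphisms A F"
  by (simp add: restr_range_endos_def)

lemma S_in: "\<phi> \<in> S \<Longrightarrow> a \<in> A \<Longrightarrow> \<phi> a \<in> B"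
  by (auto simp: restr_range_endos_def)

lemma S_I: "\<phi> \<in> endomorphisms A F \<Longrightarrow> (\<And>a. a \<in> A \<Longrightarrow> \<phi> a \<in> B) \<Longrightarrow> \<phi> \<in> S"
  by (auto simp: restr_range_endos_def)

lemma S_eq_iff: "\<phi> \<in> S \<Longrightarrow> \<psi> \<in> S \<Longrightarrow> \<phi> = \<psi> \<longleftrightarrow> (\<forall>a\<in>A. \<phi> a = \<psi> a)"
  using endo_eqI[of \<phi> \<psi>] S_endo by auto

lemma endo_mult_apply: "a \<in> A \<Longrightarrow> endo_mult A \<phi> \<psi> a = \<psi> (\<phi> a)"
  by (simp add: endo_mult_def compose_def)

lemma endo_mult_S:
  assumes "\<phi> \<in> endomorphisms A F" "\<psi> \<in> S"
  shows "endo_mult A \<phi> \<psi> \<in> S"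
  using assms by (intro S_I endo_mult_endo) (auto simp: endo_mult_apply S_endo S_in endo_in)

text \<open>The image of a free extension is generated by its values on the basis, so values in
  \<open>B\<close> keep the whole image in \<open>B\<close>.\<close>

lemma extend_map:
  assumes X: "basis_of F A X" and g: "\<And>x. x \<in> X \<Longrightarrow> g x \<in> B"
  obtains \<phi> where "\<phi> \<in> S" "\<And>x. x \<in> X \<Longrightarrow> \<phi> x = g x"
proof -
  have "g \<in> X \<rightarrow> A" using g BA by auto
  then obtain \<phi> where \<phi>: "\<phi> \<in> endomorphisms A F" "\<And>x. x \<in> X \<Longrightarrow> \<phi> x = g x"
    using free_basis[OF X] by blast
  have "\<phi> ` A = gen F (\<phi> ` X)"
    using endo_gen[OF \<phi>(1) basis_of_subset[OF X]] basis_of_gen[OF X] by simp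
  also have "\<dots> \<subseteq> gen F B" by (rule gen_mono) (use g \<phi> in auto)
  finally have "\<phi> ` A \<subseteq> B" using gen_subalgebra[OF subalgebra_B] by simp
  then have "\<phi> \<in> S" using \<phi> by (intro S_I) auto
  with \<phi> that show thesis by blast
qed

lemma S1_cases:
  assumes "x \<in> S1"
  obtains "x = None" | \<phi> where "x = Some \<phi>" "\<phi> \<in> S"
  using assms by (auto simp: monoid_ext_def split: if_splits)

lemma Some_S1: "\<phi> \<in> S \<Longrightarrow> Some \<phi> \<in> S1"
  by (auto simp: monoid_ext_def)

lemma act_in: "x \<in> S1 \<Longrightarrow> a \<in> A \<Longrightarrow> act x a \<in> A"
  by (erule S1_cases) (auto simp: S_endo endo_in)

lemma mult_ext_left:
  assumes "\<alpha> \<in> S" "x \<in> S1"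
  shows "\<exists>\<phi>\<in>S. mult_ext (endo_mult A) (Some \<alpha>) x = Some \<phi> \<and> (\<forall>a\<in>A. \<phi> a = act x (\<alpha> a))"
  using assms(2) by (rule S1_cases) (use assms(1) in \<open>auto simp: endo_mult_S S_endo endo_mult_apply\<close>)

lemma mult_ext_right:
  assumes "\<alpha> \<in> S" "x \<in> S1"
  shows "\<exists>\<phi>\<in>S. mult_ext (endo_mult A) x (Some \<alpha>) = Some \<phi> \<and> (\<forall>a\<in>A. \<phi> a = \<alpha> (act x a))"
  using assms(2) by (rule S1_cases) (use assms(1) in \<open>auto simp: endo_mult_S S_endo endo_mult_apply\<close>)

lemma mult_ext_left_eq_iff:
  assumes "\<alpha> \<in> S" "x \<in> S1" "y \<in> S1"
  shows "mult_ext (endo_mult A) (Some \<alpha>) x = mult_ext (endo_mult A) (Some \<alpha>) y \<longleftrightarrow>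
    (\<forall>b\<in>\<alpha> ` A. act x b = act y b)"
proof -
  obtain \<phi> where \<phi>: "\<phi> \<in> S" "mult_ext (endo_mult A) (Some \<alpha>) x = Some \<phi>" "\<forall>a\<in>A. \<phi> a = act x (\<alpha> a)"
    using mult_ext_left[OF assms(1,2)] by blast
  obtain \<psi> where \<psi>: "\<psi> \<in> S" "mult_ext (endo_mult A) (Some \<alpha>) y = Some \<psi>" "\<forall>a\<in>A. \<psi> a = act y (\<alpha> a)"
    using mult_ext_left[OF assms(1,3)] by blast
  show ?thesis using \<phi> \<psi> S_eq_iff[OF \<phi>(1) \<psi>(1)] by simp
qed

lemma mult_ext_right_eq_iff:
  assumes "\<alpha> \<in> S" "x \<in> S1" "y \<in> S1"
  shows "mult_ext (endo_mult A) x (Some \<alpha>) = mult_ext (endo_mult A) y (Some \<alpha>) \<longleftrightarrow>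
    (\<forall>a\<in>A. \<alpha> (act x a) = \<alpha> (act y a))"
proof -
  obtain \<phi> where \<phi>: "\<phi> \<in> S" "mult_ext (endo_mult A) x (Some \<alpha>) = Some \<phi>" "\<forall>a\<in>A. \<phi> a = \<alpha> (act x a)"
    using mult_ext_right[OF assms(1,2)] by blast
  obtain \<psi> where \<psi>: "\<psi> \<in> S" "mult_ext (endo_mult A) y (Some \<alpha>) = Some \<psi>" "\<forall>a\<in>A. \<psi> a = \<alpha> (act y a)"
    using mult_ext_right[OF assms(1,3)] by blast
  show ?thesis using \<phi> \<psi> S_eq_iff[OF \<phi>(1) \<psi>(1)] by simp
qed

lemma Ls_iff: "(\<alpha>, \<beta>) \<in> Ls \<longleftrightarrow> \<alpha> \<in> S \<and> \<beta> \<in> S \<and> (\<forall>x\<in>S1. \<forall>y\<in>S1.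
    (\<forall>b\<in>\<alpha> ` A. act x b = act y b) \<longleftrightarrow> (\<forall>b\<in>\<beta> ` A. act x b = act y b))"
  by (simp add: L_star_def mult_ext_left_eq_iff del: mult_ext.simps cong: conj_cong ball_cong)

lemma Rs_iff: "(\<alpha>, \<beta>) \<in> Rs \<longleftrightarrow> \<alpha> \<in> S \<and> \<beta> \<in> S \<and> (\<forall>x\<in>S1. \<forall>y\<in>S1.
    (\<forall>a\<in>A. \<alpha> (act x a) = \<alpha> (act y a)) \<longleftrightarrow> (\<forall>a\<in>A. \<beta> (act x a) = \<beta> (act y a)))"
  by (simp add: R_star_def mult_ext_right_eq_iff del: mult_ext.simps cong: conj_cong ball_cong)

lemma Rs_sym: "(\<alpha>, \<beta>) \<in> Rs \<Longrightarrow> (\<beta>, \<alpha>) \<in> Rs"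
  by (auto simp: R_star_def)

lemma Ls_sym: "(\<alpha>, \<beta>) \<in> Ls \<Longrightarrow> (\<beta>, \<alpha>) \<in> Ls"
  by (auto simp: L_star_def)

text \<open>Supplies the identity in whichever form \<open>S1\<close> contains it, so that it need
  not be decided whether \<open>S\<close> is itself a monoid.\<close>

lemma S1_identity: "\<exists>i\<in>S1. \<forall>\<alpha>\<in>S. \<forall>a\<in>A. \<alpha> (act i a) = \<alpha> a"
proof (cases "has_identity S (endo_mult A)")
  case True
  then obtain u where u: "u \<in> S" "\<And>\<alpha>. \<alpha> \<in> S \<Longrightarrow> endo_mult A u \<alpha> = \<alpha>"
    by (auto simp: has_identity_def)
  have "\<alpha> (u a) = \<alpha> a" if "\<alpha> \<in> S" "a \<in> A" for \<alpha> a
    using u(2)[OF that(1)] endo_mult_apply[OF that(2), of u \<alpha>] by simp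
  with u show ?thesis by (intro bexI[of _ "Some u"]) (auto simp: Some_S1)
next
  case False
  then show ?thesis by (intro bexI[of _ None]) (auto simp: monoid_ext_def)
qed

section \<open>The relation \<open>Ls\<close> and images\<close>

lemma Ls_image_eq: "\<alpha> \<in> S \<Longrightarrow> \<beta> \<in> S \<Longrightarrow> \<alpha> ` A = \<beta> ` A \<Longrightarrow> (\<alpha>, \<beta>) \<in> Ls"
  unfolding Ls_iff by simp

text \<open>A point \<open>v\<close> of the first image outside the second would be separated from
  it: two maps that fix a basis of the second image and send \<open>v\<close> to different elements
  of \<open>B\<close> agree on that image but not at \<open>v\<close>.\<close>

lemma Ls_image_subset:
  assumes "(\<alpha>, \<beta>) \<in> Ls"
  shows "\<alpha> ` A \<subseteq> \<beta> ` A"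
proof (rule ccontr)
  have S: "\<alpha> \<in> S" "\<beta> \<in> S" using assms by (auto simp: Ls_iff)
  assume "\<not> \<alpha> ` A \<subseteq> \<beta> ` A"
  then obtain v where v: "v \<in> \<alpha> ` A" "v \<notin> \<beta> ` A" by blast
  have im: "subalgebra A F (\<beta> ` A)" by (rule endo_image_subalgebra[OF S_endo[OF S(2)] subalgebra_UNIV])
  obtain Y where Y: "basis_of F (\<beta> ` A) Y" using basis_exists[OF im] .
  have gY: "gen F Y = \<beta> ` A" and YA: "Y \<subseteq> A" and YB: "Y \<subseteq> \<beta> ` A"
    using Y basis_of_subset[OF Y] subalgebra_carrier[OF im] by (auto simp: basis_of_def)
  have vA: "v \<in> A" using v S(1) S_in BA by auto
  have "gen.indep Y" using Y subalgebra_carrier[OF im] by (simp add: basis_of_iff)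
  then have "gen.indep (insert v Y)" using gen.indep_insert vA v gY by simp
  then obtain X where X: "insert v Y \<subseteq> X" "basis_of F A X"
    using basis_extend[OF subalgebra_UNIV, of "insert v Y"] vA YA by auto
  obtain b b' where b: "b \<in> B" "b' \<in> B" "b \<noteq> b'" using B_two by blast
  \<comment> \<open>Fixing \<open>Y\<close> is compatible with the restricted range because
    \<open>Y\<close> lies in the image of \<beta>.\<close>
  have g: "(if x \<in> Y then x else c) \<in> B" if "c \<in> B" for x c using that YB S_in[OF S(2)] by auto
  obtain \<phi> where \<phi>: "\<phi> \<in> S" "\<And>x. x \<in> X \<Longrightarrow> \<phi> x = (if x \<in> Y then x else b)"
    using extend_map[OF X(2), of "\<lambda>x. if x \<in> Y then x else b", OF g[OF b(1)]] by blast
  obtain \<psi> where \<psi>: "\<psi> \<in> S" "\<And>x. x \<in> X \<Longrightarrow> \<psi> x = (if x \<in> Y then x else b')"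
    using extend_map[OF X(2), of "\<lambda>x. if x \<in> Y then x else b'", OF g[OF b(2)]] by blast
  have "\<phi> x = \<psi> x" if "x \<in> \<beta> ` A" for x
  proof (rule endo_eq_on_gen[OF S_endo[OF \<phi>(1)] S_endo[OF \<psi>(1)] YA])
    show "\<phi> y = \<psi> y" if "y \<in> Y" for y using that X \<phi>(2)[of y] \<psi>(2)[of y] by auto
    show "x \<in> gen F Y" using that gY by simp
  qed
  then have "\<forall>b\<in>\<beta> ` A. act (Some \<phi>) b = act (Some \<psi>) b" by auto
  then have "\<forall>b\<in>\<alpha> ` A. act (Some \<phi>) b = act (Some \<psi>) b"
    using assms Some_S1[OF \<phi>(1)] Some_S1[OF \<psi>(1)] unfolding Ls_iff by blast
  then have "\<phi> v = \<psi> v" using v by auto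
  moreover have "v \<notin> Y" using v YB by auto
  ultimately show False using \<phi>(2)[of v] \<psi>(2)[of v] X b by auto
qed

lemma Ls_image: "(\<alpha>, \<beta>) \<in> Ls \<Longrightarrow> \<alpha> ` A = \<beta> ` A"
  using Ls_image_subset Ls_sym by blast

lemma Ls_rank_eq:
  assumes "(\<alpha>, \<beta>) \<in> Ls"
  shows "rk \<alpha> =o rk \<beta>"
  using Ls_image[OF assms] card_of_refl unfolding alg_rank_def alg_dim_def by simp

section \<open>The relation \<open>Rs\<close> and kernels\<close>

lemma basis_A_nonempty:
  assumes "basis_of F A X"
  shows "X \<noteq> {}"
proof
  assume "X = {}"
  then have "A \<subseteq> B"
    using basis_of_gen[OF assms] gen_mono[of "{}" B F] gen_subalgebra[OF subalgebra_B] by simp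
  with BA B_proper show False by simp
qed

text \<open>The test maps send a whole basis of \<open>A\<close> to \<open>b\<close> and to
  \<open>b'\<close>. Followed by \<alpha> they agree on the basis, hence everywhere; by
  \<open>Rs\<close> the same holds for \<beta>, and evaluation at one basis element gives the
  claim.\<close>

lemma Rs_kernel:
  assumes R: "(\<alpha>, \<beta>) \<in> Rs" and b: "b \<in> B" "b' \<in> B" and eq: "\<alpha> b = \<alpha> b'"
  shows "\<beta> b = \<beta> b'"
proof -
  have S: "\<alpha> \<in> S" "\<beta> \<in> S" using R by (auto simp: Rs_iff)
  obtain X where X: "basis_of F A X" using basis_exists[OF subalgebra_UNIV] .
  obtain \<phi> where \<phi>: "\<phi> \<in> S" "\<And>x. x \<in> X \<Longrightarrow> \<phi> x = b" using extend_map[OF X, of "\<lambda>_. b"] b by auto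
  obtain \<psi> where \<psi>: "\<psi> \<in> S" "\<And>x. x \<in> X \<Longrightarrow> \<psi> x = b'" using extend_map[OF X, of "\<lambda>_. b'"] b by auto
  have XA: "X \<subseteq> A" using X by (rule basis_of_subset)
  have "endo_mult A \<phi> \<alpha> a = endo_mult A \<psi> \<alpha> a" if "a \<in> A" for a
  proof (rule endo_eq_on_gen[of "endo_mult A \<phi> \<alpha>" "endo_mult A \<psi> \<alpha>", OF _ _ XA])
    show "endo_mult A \<phi> \<alpha> \<in> endomorphisms A F" "endo_mult A \<psi> \<alpha> \<in> endomorphisms A F"
      using S \<phi>(1) \<psi>(1) by (simp_all add: endo_mult_endo S_endo)
    show "endo_mult A \<phi> \<alpha> x = endo_mult A \<psi> \<alpha> x" if "x \<in> X" for x
      using that XA eq \<phi>(2) \<psi>(2) by (auto simp: endo_mult_apply)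
    show "a \<in> gen F X" using that basis_of_gen[OF X] by simp
  qed
  then have "\<forall>a\<in>A. \<alpha> (act (Some \<phi>) a) = \<alpha> (act (Some \<psi>) a)" by (simp add: endo_mult_apply)
  then have \<beta>: "\<forall>a\<in>A. \<beta> (act (Some \<phi>) a) = \<beta> (act (Some \<psi>) a)"
    using R Some_S1[OF \<phi>(1)] Some_S1[OF \<psi>(1)] unfolding Rs_iff by blast
  obtain x where "x \<in> X" using basis_A_nonempty[OF X] by blast
  then show ?thesis using \<beta> \<phi>(2)[of x] \<psi>(2)[of x] XA by auto
qed

text \<open>If \<alpha> attains all its values on \<open>B\<close>, preimages in \<open>B\<close> of
  its values on a basis define a \<phi> in \<open>S\<close> that is a left identity for \<alpha>.
  Comparing \<phi> with the identity of \<open>S1\<close> transfers this to \<beta>.\<close>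

lemma Rs_retraction:
  assumes R: "(\<alpha>, \<beta>) \<in> Rs" and im: "\<alpha> ` B = \<alpha> ` A"
  shows "\<exists>\<phi>\<in>S. \<forall>a\<in>A. \<alpha> (\<phi> a) = \<alpha> a \<and> \<beta> (\<phi> a) = \<beta> a"
proof -
  have S: "\<alpha> \<in> S" "\<beta> \<in> S" using R by (auto simp: Rs_iff)
  obtain X where X: "basis_of F A X" using basis_exists[OF subalgebra_UNIV] .
  have XA: "X \<subseteq> A" using X by (rule basis_of_subset)
  have "\<forall>x\<in>X. \<exists>b\<in>B. \<alpha> b = \<alpha> x" using im XA by (metis image_iff subsetD)
  then obtain g where g: "\<And>x. x \<in> X \<Longrightarrow> g x \<in> B \<and> \<alpha> (g x) = \<alpha> x" by metis
  obtain \<phi> where \<phi>: "\<phi> \<in> S" "\<And>x. x \<in> X \<Longrightarrow> \<phi> x = g x" using extend_map[OF X, of g] g by auto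
  have "endo_mult A \<phi> \<alpha> a = \<alpha> a" if "a \<in> A" for a
  proof (rule endo_eq_on_gen[of "endo_mult A \<phi> \<alpha>" \<alpha>, OF _ _ XA])
    show "endo_mult A \<phi> \<alpha> \<in> endomorphisms A F" "\<alpha> \<in> endomorphisms A F"
      using S \<phi>(1) by (simp_all add: endo_mult_endo S_endo)
    show "endo_mult A \<phi> \<alpha> x = \<alpha> x" if "x \<in> X" for x
      using that XA g \<phi>(2) by (auto simp: endo_mult_apply)
    show "a \<in> gen F X" using that basis_of_gen[OF X] by simp
  qed
  then have \<alpha>: "\<forall>a\<in>A. \<alpha> (\<phi> a) = \<alpha> a" by (simp add: endo_mult_apply)
  obtain i where i: "i \<in> S1" "\<And>\<gamma> a. \<gamma> \<in> S \<Longrightarrow> a \<in> A \<Longrightarrow> \<gamma> (act i a) = \<gamma> a"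
    using S1_identity by blast
  have "\<forall>a\<in>A. \<alpha> (act (Some \<phi>) a) = \<alpha> (act i a)" using \<alpha> i(2)[OF S(1)] by simp
  then have "\<forall>a\<in>A. \<beta> (act (Some \<phi>) a) = \<beta> (act i a)"
    using R Some_S1[OF \<phi>(1)] i(1) unfolding Rs_iff by blast
  then have "\<forall>a\<in>A. \<beta> (\<phi> a) = \<beta> a" using i(2)[OF S(2)] by simp
  with \<alpha> \<phi>(1) show ?thesis by blast
qed

lemma Rs_same_kernel_B: "(\<alpha>, \<beta>) \<in> Rs \<Longrightarrow> same_kernel B \<alpha> \<beta>"
  unfolding same_kernel_def using Rs_kernel Rs_sym by metis

text \<open>The map \<phi> moves all points into \<open>B\<close> without changing their values
  under \<alpha> and \<beta>, so the kernels on \<open>A\<close> are determined by those on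
  \<open>B\<close>.\<close>

lemma Rs_same_kernel_A:
  assumes R: "(\<alpha>, \<beta>) \<in> Rs" and im: "\<alpha> ` B = \<alpha> ` A"
  shows "same_kernel A \<alpha> \<beta>"
proof -
  obtain \<phi> where \<phi>: "\<phi> \<in> S" "\<And>a. a \<in> A \<Longrightarrow> \<alpha> (\<phi> a) = \<alpha> a" "\<And>a. a \<in> A \<Longrightarrow> \<beta> (\<phi> a) = \<beta> a"
    using Rs_retraction[OF assms] by blast
  have "\<alpha> a = \<alpha> b \<longleftrightarrow> \<beta> a = \<beta> b" if "a \<in> A" "b \<in> A" for a b
    using Rs_same_kernel_B[OF R] \<phi>(2,3) that S_in[OF \<phi>(1)] unfolding same_kernel_def by metis
  then show ?thesis by (simp add: same_kernel_def)
qed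

lemma Rs_cases:
  assumes "(\<alpha>, \<beta>) \<in> Rs"
  obtains "same_kernel A \<alpha> \<beta>"
  | "same_kernel B \<alpha> \<beta>" "\<alpha> ` B \<noteq> \<alpha> ` A" "\<beta> ` B \<noteq> \<beta> ` A"
  using assms Rs_same_kernel_A[of \<alpha> \<beta>] Rs_same_kernel_A[of \<beta> \<alpha>] Rs_same_kernel_B[of \<alpha> \<beta>]
    Rs_sym[of \<alpha> \<beta>] same_kernel_sym[of A \<beta> \<alpha>] by blast

lemma Rs_same_kernel_AI:
  assumes "\<alpha> \<in> S" "\<beta> \<in> S" "same_kernel A \<alpha> \<beta>"
  shows "(\<alpha>, \<beta>) \<in> Rs"
  using assms act_in unfolding Rs_iff same_kernel_def by simp

text \<open>Two elements of \<open>S\<close> have values in \<open>B\<close>, where the kernels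
  agree. An element of \<open>S\<close> and the adjoined identity are equalised by neither map,
  since otherwise every value would be attained on \<open>B\<close>.\<close>

lemma Rs_same_kernel_BI:
  assumes S: "\<alpha> \<in> S" "\<beta> \<in> S" and ker: "same_kernel B \<alpha> \<beta>"
    and im: "\<alpha> ` B \<noteq> \<alpha> ` A" "\<beta> ` B \<noteq> \<beta> ` A"
  shows "(\<alpha>, \<beta>) \<in> Rs"
proof -
  have no: "\<not> (\<forall>a\<in>A. \<gamma> a = \<gamma> (\<phi> a))" "\<not> (\<forall>a\<in>A. \<gamma> (\<phi> a) = \<gamma> a)"
    if "\<phi> \<in> S" "\<gamma> ` B \<noteq> \<gamma> ` A" for \<gamma> \<phi>
  proof -
    have False if *: "\<forall>a\<in>A. \<gamma> a = \<gamma> (\<phi> a)"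
    proof -
      have "\<gamma> ` A \<subseteq> \<gamma> ` B" using * S_in[OF \<open>\<phi> \<in> S\<close>] by (metis image_eqI image_subsetI)
      with that \<open>\<gamma> ` B \<noteq> \<gamma> ` A\<close> BA show False by (metis image_mono subset_antisym)
    qed
    then show "\<not> (\<forall>a\<in>A. \<gamma> a = \<gamma> (\<phi> a))" "\<not> (\<forall>a\<in>A. \<gamma> (\<phi> a) = \<gamma> a)" by metis+
  qed
  have "(\<forall>a\<in>A. \<alpha> (act x a) = \<alpha> (act y a)) \<longleftrightarrow> (\<forall>a\<in>A. \<beta> (act x a) = \<beta> (act y a))"
    if "x \<in> S1" "y \<in> S1" for x y
    using that(1)
  proof (cases rule: S1_cases)
    case 1
    note x = 1
    show ?thesis using that(2)
    proof (cases rule: S1_cases)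
      case 1
      with x show ?thesis by simp
    next
      case (2 \<psi>)
      with x no(1)[of \<psi> \<alpha>] no(1)[of \<psi> \<beta>] im show ?thesis by auto
    qed
  next
    case (2 \<phi>)
    note x = 2
    show ?thesis using that(2)
    proof (cases rule: S1_cases)
      case 1
      with x no(2)[of \<phi> \<alpha>] no(2)[of \<phi> \<beta>] im show ?thesis by auto
    next
      case (2 \<psi>)
      with x ker show ?thesis by (simp add: same_kernel_def S_in)
    qed
  qed
  with S show ?thesis unfolding Rs_iff by blast
qed

end

subsection \<open>Ranks up to the codimension\<close>

text \<open>The condition that (II) or (III) puts on one of two different ranks, in codimension
  \<open>c\<close>. Stated for a single rank, it makes the claimed relation easy to recognise as an
  equivalence.\<close>

definition mid_rank :: "'a rel \<Rightarrow> nat \<Rightarrow> 'b rel \<Rightarrow> bool" where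
  "mid_rank c e r \<longleftrightarrow>
    (fin_card 2 \<le>o c \<and> c <o natLeq \<and> fin_card e <o r \<and> r <o natLeq) \<or>
    (natLeq \<le>o c \<and> fin_card e <o r \<and> r \<le>o c)"

lemma mid_rank_card_of:
  assumes c: "c =o |Z|" and r: "r =o |Y|"
  shows "mid_rank c e r \<longleftrightarrow> (if finite Z then 2 \<le> card Z \<and> finite Y \<and> e < card Y
    else |Y| \<le>o |Z| \<and> (infinite Y \<or> e < card Y))"
proof -
  have c2: "fin_card 2 \<le>o c \<longleftrightarrow> infinite Z \<or> 2 \<le> card Z"
    using ordLeq_cong_right[OF c] fin_card_ordLeq_card_of by blast
  have cfin: "c <o natLeq \<longleftrightarrow> finite Z" "natLeq \<le>o c \<longleftrightarrow> infinite Z"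
    using ordLess_cong_left[OF c] ordLeq_cong_right[OF c] finite_iff_ordLess_natLeq
      infinite_iff_natLeq_ordLeq by blast+
  have r: "fin_card e <o r \<longleftrightarrow> infinite Y \<or> e < card Y" "r <o natLeq \<longleftrightarrow> finite Y" "r \<le>o c \<longleftrightarrow> |Y| \<le>o |Z|"
    using ordLess_cong_right[OF r] fin_card_ordLess_card_of ordLess_cong_left[OF r]
      finite_iff_ordLess_natLeq ordLeq_cong[OF r c] by blast+
  show ?thesis unfolding mid_rank_def c2 cfin r by auto
qed

text \<open>\<open>P\<close> has size \<mu>, and \<open>W\<close>, \<open>W'\<close> are the
  surpluses \<nu>, \<nu>'. An infinite \<open>P\<close> at least as large as \<open>Z\<close>
  absorbs both; if \<open>Z\<close> has at most one element, both surpluses are single elements;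
  otherwise both sums are in the range.\<close>

lemma rank_dichotomy:
  fixes W W' :: "'c set"
  assumes c: "c =o |Z|"
    and W: "W \<noteq> {}" "|W| \<le>o |Z|" and W': "W' \<noteq> {}" "|W'| \<le>o |Z|"
    and e: "infinite P \<or> e \<le> card P"
    and r: "r =o |P <+> W|" "r' =o |P <+> W'|"
  shows "r =o r' \<or> mid_rank c e r \<and> mid_rank c e r'"
proof -
  have fin: "finite V" "card V \<le> card Z" if "finite Z" "|V| \<le>o |Z|" for V :: "'c set"
  proof -
    show "finite V" using card_of_ordLeq_finite that by blast
    then show "card V \<le> card Z" using that finite_card_of_ordLeq by blast
  qed
  have mid: "mid_rank c e s"
    if V: "V \<noteq> {}" "|V| \<le>o |Z|" "s =o |P <+> V|"
      and P: "finite Z \<and> 2 \<le> card Z \<and> finite P \<or> infinite Z \<and> |P| \<le>o |Z|" for V :: "'c set" and s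
  proof (cases "finite Z")
    case True
    have "finite V" using fin[OF True V(2)] by simp
    \<comment> \<open>The non-empty surplus turns the bound \<open>e \<le> card P\<close> into the
      strict one required of the rank.\<close>
    then have "0 < card V" using V(1) by (simp add: card_gt_0_iff)
    then have "e < card (P <+> V)" using e P True \<open>finite V\<close> by (simp add: card_Plus)
    with P True \<open>finite V\<close> show ?thesis unfolding mid_rank_card_of[OF c V(3)] by auto
  next
    case False
    have "infinite (P <+> V) \<or> e < card (P <+> V)"
    proof (cases "finite P \<and> finite V")
      case True
      then have "0 < card V" using V(1) by (simp add: card_gt_0_iff)
      then show ?thesis using e True by (simp add: card_Plus)
    qed auto
    moreover have "|P <+> V| \<le>o |Z|"
      using card_of_Plus_ordLeq_infinite_Field[of "|Z|" P V, OF _ _ _ card_of_Card_order] False P V(2)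
      by (simp add: Field_card_of)
    ultimately show ?thesis using False unfolding mid_rank_card_of[OF c V(3)] by auto
  qed
  consider "infinite P" "|Z| \<le>o |P|" | "finite Z" "card Z \<le> 1"
    | "finite Z \<and> 2 \<le> card Z \<and> finite P \<or> infinite Z \<and> |P| \<le>o |Z|"
  proof (cases "finite Z")
    case True
    then show ?thesis
      using that finite_ordLess_infinite_card_of[of Z P] ordLess_imp_ordLeq by (cases "finite P") force+
  next
    case False
    then show ?thesis
      using that ordLeq_total[of "|P|" "|Z|"] card_of_ordLeq_finite[of Z P]
        card_of_Well_order[of P] card_of_Well_order[of Z] by blast
  qed
  then show ?thesis
  proof cases
    case 1
    have "|P <+> W| =o |P|" "|P <+> W'| =o |P|"
      using 1 W(2) W'(2) card_of_Plus_infinite1 ordLeq_transitive by blast+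
    then show ?thesis using r by (meson ordIso_symmetric ordIso_transitive)
  next
    case 2
    have "finite W" "card W = 1" "finite W'" "card W' = 1"
      using fin[OF 2(1) W(2)] fin[OF 2(1) W'(2)] 2 W(1) W'(1)
      by (auto simp: le_Suc_eq card_gt_0_iff)
    then have "|W| =o |W'|"
      using finite_card_of_ordLeq[of W W'] finite_card_of_ordLeq[of W' W] by (simp add: ordIso_iff_ordLeq)
    then have "|P <+> W| =o |P <+> W'|" by (rule card_of_Plus_cong2)
    then show ?thesis using r by (meson ordIso_symmetric ordIso_transitive)
  next
    case 3
    then show ?thesis using mid[OF W r(1)] mid[OF W' r(2)] by blast
  qed
qed

lemma classification_iff:
  assumes c: "c =o |Z|" "Z \<noteq> {}"
  shows "(c =o fin_card 1 \<and> q) \<or>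
      (fin_card 2 \<le>o c \<and> c <o natLeq \<and>
        ((fin_card e <o r \<and> r <o natLeq \<and> fin_card e <o r' \<and> r' <o natLeq) \<or> q)) \<or>
      (natLeq \<le>o c \<and> ((fin_card e <o r \<and> r \<le>o c \<and> fin_card e <o r' \<and> r' \<le>o c) \<or> q))
    \<longleftrightarrow> q \<or> mid_rank c e r \<and> mid_rank c e r'"
proof -
  have one: "c =o fin_card 1 \<longleftrightarrow> finite Z \<and> card Z = 1"
    unfolding card_of_ordIso_fin_card[symmetric] using c(1) by (meson ordIso_symmetric ordIso_transitive)
  have two: "fin_card 2 \<le>o c \<longleftrightarrow> infinite Z \<or> 2 \<le> card Z"
    using ordLeq_cong_right[OF c(1)] fin_card_ordLeq_card_of by blast
  have less: "c <o natLeq \<longleftrightarrow> finite Z"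
    using ordLess_cong_left[OF c(1)] finite_iff_ordLess_natLeq by blast
  have ge: "natLeq \<le>o c \<longleftrightarrow> infinite Z"
    using ordLeq_cong_right[OF c(1)] infinite_iff_natLeq_ordLeq by blast
  have "finite Z \<Longrightarrow> card Z = 1 \<or> 2 \<le> card Z" using c(2) card_gt_0_iff[of Z] by force
  then show ?thesis unfolding mid_rank_def one two less ge by blast
qed

context restricted_range
begin

abbreviation "cd \<equiv> alg_codim A F B"
abbreviation "mid \<phi> \<equiv> mid_rank cd (const_defect F) (rk \<phi>)"

section \<open>Ranks of \<open>Rs\<close>-related maps\<close>

lemma complement_nonempty:
  assumes "basis_of F B X" "basis_of F A (X \<union> Z)"
  shows "Z \<noteq> {}"
  using basis_of_gen[OF assms(1)] basis_of_gen[OF assms(2)] B_proper by auto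

lemma image_indep:
  assumes "\<phi> \<in> S" "basis_of F (\<phi> ` A) Y"
  shows "gen.indep Y" "Y \<subseteq> B" "gen F Y = \<phi> ` A"
  using assms basis_of_iff[OF endo_image_carrier[OF S_endo[OF assms(1)] subset_refl], of Y] S_in[OF assms(1)]
  by auto

lemma image_basis_exists:
  assumes "\<phi> \<in> S"
  obtains Y where "basis_of F (\<phi> ` A) Y"
  using basis_exists[OF endo_image_subalgebra[OF S_endo[OF assms] subalgebra_UNIV]] .

text \<open>Extending the basis \<alpha> P of B\<alpha> by elements of \<alpha> Z gives a basis of
  A\<alpha>, because \<alpha> P already generates \<alpha> X. The added elements number at most
  \<open>|Z|\<close>, and there is one because B\<alpha> \<noteq> A\<alpha>.\<close>

lemma rank_decomposition:
  assumes \<alpha>: "\<alpha> \<in> S" and P: "P \<subseteq> B" "inj_on \<alpha> P" "basis_of F (\<alpha> ` B) (\<alpha> ` P)"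
    and im: "\<alpha> ` B \<noteq> \<alpha> ` A"
    and X: "basis_of F B X" "basis_of F A (X \<union> Z)"
  shows "\<exists>W :: 'a set. W \<noteq> {} \<and> |W| \<le>o |Z| \<and> rk \<alpha> =o |P <+> W|"
proof -
  have en: "\<alpha> \<in> endomorphisms A F" using \<alpha> by (rule S_endo)
  have XZ: "X \<subseteq> A" "Z \<subseteq> A" "X \<subseteq> B" using basis_of_subset[OF X(2)] basis_of_subset[OF X(1)] by auto
  have "\<alpha> ` B \<subseteq> A" using endo_image_carrier[OF en BA] .
  then have ind: "gen.indep (\<alpha> ` P)" using P(3) by (simp add: basis_of_iff)
  have "\<alpha> ` P \<union> \<alpha> ` Z \<subseteq> A" using endo_image_carrier[OF en] P(1) BA XZ by blast
  then obtain V where V: "\<alpha> ` P \<subseteq> V" "V \<subseteq> \<alpha> ` P \<union> \<alpha> ` Z" "gen.indep V" "\<alpha> ` P \<union> \<alpha> ` Z \<subseteq> gen F V"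
    using gen.indep_extend[OF ind Un_upper1] by metis
  have imA: "\<alpha> ` A = gen F (\<alpha> ` (X \<union> Z))"
    using endo_gen[OF en basis_of_subset[OF X(2)]] basis_of_gen[OF X(2)] by simp
  have "\<alpha> ` X \<subseteq> gen F V"
    using XZ(3) basis_of_gen[OF P(3)] gen_mono[OF V(1), of F] by auto
  then have "\<alpha> ` A \<subseteq> gen F V" unfolding imA using V(4) by (intro gen_least) auto
  moreover have VA: "V \<subseteq> \<alpha> ` A"
    using V(2) image_mono[OF subset_trans[OF P(1) BA], of \<alpha>] image_mono[OF XZ(2), of \<alpha>]
    by (meson Un_least subset_trans)
  moreover have "gen F V \<subseteq> \<alpha> ` A"
    using gen_mono[OF VA, of F] gen_subalgebra[OF endo_image_subalgebra[OF en subalgebra_UNIV]] by simp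
  ultimately have bas: "basis_of F (\<alpha> ` A) V"
    unfolding basis_of_iff[OF endo_image_carrier[OF en subset_refl]] using V(3) by blast
  define W where "W = V - \<alpha> ` P"
  have "W \<noteq> {}"
  proof
    assume "W = {}"
    then have "V = \<alpha> ` P" using V(1) by (auto simp: W_def)
    then show False using basis_of_gen[OF bas] basis_of_gen[OF P(3)] im by simp
  qed
  moreover have "|W| \<le>o |Z|"
  proof -
    have "W \<subseteq> \<alpha> ` Z" using V(2) by (auto simp: W_def)
    then show ?thesis using card_of_mono1 card_of_image ordLeq_transitive by blast
  qed
  moreover have "rk \<alpha> =o |P <+> W|"
  proof -
    have "V = \<alpha> ` P \<union> W" "\<alpha> ` P \<inter> W = {}" using V(1) by (auto simp: W_def)
    then have "|V| =o |\<alpha> ` P <+> W|" using card_of_Un_disjoint by metis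
    moreover have "|\<alpha> ` P <+> W| =o |P <+> W|" by (rule card_of_Plus_cong1[OF card_of_image_inj[OF P(2)]])
    ultimately show ?thesis using alg_rank_basis[OF en bas] by (meson ordIso_transitive)
  qed
  ultimately show ?thesis by blast
qed

lemma Rs_rank:
  assumes R: "(\<alpha>, \<beta>) \<in> Rs"
  shows "rk \<alpha> =o rk \<beta> \<or> mid \<alpha> \<and> mid \<beta>"
  using R
proof (cases rule: Rs_cases)
  case 1
  then show ?thesis using rank_eq_of_same_kernel[of \<alpha> \<beta>] R by (auto simp: Rs_iff S_endo)
next
  case 2
  have S: "\<alpha> \<in> S" "\<beta> \<in> S" using R by (auto simp: Rs_iff)
  obtain P where P: "P \<subseteq> B" "inj_on \<alpha> P" "inj_on \<beta> P"
    "basis_of F (\<alpha> ` B) (\<alpha> ` P)" "basis_of F (\<beta> ` B) (\<beta> ` P)"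
    using common_transversal[OF subalgebra_B S_endo[OF S(1)] S_endo[OF S(2)] 2(1)] .
  obtain X where X: "basis_of F B X" using basis_exists[OF subalgebra_B] .
  obtain Z where Z: "X \<inter> Z = {}" "basis_of F A (X \<union> Z)" using complement_exists[OF subalgebra_B X] .
  obtain W :: "'a set" where W: "W \<noteq> {}" "|W| \<le>o |Z|" "rk \<alpha> =o |P <+> W|"
    using rank_decomposition[OF S(1) P(1,2,4) 2(2) X Z(2)] by blast
  obtain W' :: "'a set" where W': "W' \<noteq> {}" "|W'| \<le>o |Z|" "rk \<beta> =o |P <+> W'|"
    using rank_decomposition[OF S(2) P(1,3,5) 2(3) X Z(2)] by blast
  \<comment> \<open>This is \<mu> \<ge> e: without constants the empty set cannot generate the
    non-empty image of \<open>B\<close>.\<close>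
  have "infinite P \<or> const_defect F \<le> card P"
  proof (cases "gen F {} = {}")
    case True
    have "\<alpha> ` P \<noteq> {}" using basis_of_gen[OF P(4)] B_nonempty True by auto
    then show ?thesis by (cases "finite P") (auto simp: const_defect_def Suc_le_eq card_gt_0_iff)
  qed (simp add: const_defect_def)
  then show ?thesis
    using rank_dichotomy[OF alg_codim_complement[OF subalgebra_B X Z] W(1,2) W'(1,2) _ W(3) W'(3)] by blast
qed

section \<open>Construction of linking maps\<close>

lemma equal_rank_link:
  assumes S: "\<alpha> \<in> S" "\<beta> \<in> S" and rk: "rk \<alpha> =o rk \<beta>"
  shows "(\<alpha>, \<beta>) \<in> Rs O Ls"
proof -
  obtain Y where Y: "basis_of F (\<alpha> ` A) Y" using image_basis_exists[OF S(1)] .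
  obtain Y' where Y': "basis_of F (\<beta> ` A) Y'" using image_basis_exists[OF S(2)] .
  note y = image_indep[OF S(1) Y] and y' = image_indep[OF S(2) Y']
  have YA: "Y \<subseteq> A" "Y' \<subseteq> A" using y(2) y'(2) BA by auto
  have "|Y| =o |Y'|"
    using alg_rank_basis[OF S_endo[OF S(1)] Y] alg_rank_basis[OF S_endo[OF S(2)] Y'] rk
    by (meson ordIso_symmetric ordIso_transitive)
  then obtain h where h: "bij_betw h Y Y'" using card_of_ordIso by blast
  obtain b where b: "b \<in> B" using B_nonempty by blast
  obtain X where X: "Y \<subseteq> X" "basis_of F A X" using basis_extend[OF subalgebra_UNIV y(1) YA(1)] .
  obtain X' where X': "Y' \<subseteq> X'" "basis_of F A X'" using basis_extend[OF subalgebra_UNIV y'(1) YA(2)] .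
  define g where "g x = (if x \<in> Y then h x else b)" for x
  have gB: "g x \<in> B" for x using h y'(2) b by (auto simp: g_def bij_betw_def)
  obtain \<theta> where \<theta>: "\<theta> \<in> S" "\<And>x. x \<in> X \<Longrightarrow> \<theta> x = g x" using extend_map[OF X(2), of g, OF gB] by blast
  \<comment> \<open>The extension \<psi> of \<open>g'\<close> undoes \<theta> on the image of
    \<alpha>. It witnesses that \<theta> is injective there, so \<alpha> followed by \<theta> has
    the kernel of \<alpha>.\<close>
  define g' where "g' x = (if x \<in> Y' then inv_into Y h x else b)" for x
  have gB': "g' x \<in> B" for x
    using bij_betw_inv_into[OF h] y(2) b by (auto simp: g'_def bij_betw_def)
  obtain \<psi> where \<psi>: "\<psi> \<in> S" "\<And>x. x \<in> X' \<Longrightarrow> \<psi> x = g' x" using extend_map[OF X'(2), of g', OF gB'] by blast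
  have hY: "h v \<in> Y'" if "v \<in> Y" for v using that h by (auto simp: bij_betw_def)
  have \<theta>Y: "\<theta> v = h v" if "v \<in> Y" for v using that X \<theta>(2)[of v] by (auto simp: g_def)
  have \<psi>Y: "\<psi> (h v) = v" if "v \<in> Y" for v
    using hY[OF that] X'(1) \<psi>(2)[of "h v"] bij_betw_inv_into_left[OF h that] by (auto simp: g'_def)
  have inv: "endo_mult A \<theta> \<psi> v = (\<lambda>x\<in>A. x) v" if "v \<in> gen F Y" for v
  proof (rule endo_eq_on_gen[of "endo_mult A \<theta> \<psi>" "\<lambda>x\<in>A. x", OF _ id_endo YA(1) _ that])
    show "endo_mult A \<theta> \<psi> \<in> endomorphisms A F" using \<theta>(1) \<psi>(1) by (simp add: endo_mult_endo S_endo)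
    show "endo_mult A \<theta> \<psi> x = (\<lambda>x\<in>A. x) x" if "x \<in> Y" for x
      using that YA(1) \<theta>Y \<psi>Y by (auto simp: endo_mult_apply)
  qed
  have imA: "a \<in> A \<Longrightarrow> \<alpha> a \<in> A" for a using S_in[OF S(1)] BA by auto
  have inv': "\<psi> (\<theta> (\<alpha> a)) = \<alpha> a" if "a \<in> A" for a
    using inv[of "\<alpha> a"] y(3) that imA by (simp add: endo_mult_apply)
  define \<gamma> where "\<gamma> = endo_mult A \<alpha> \<theta>"
  have \<gamma>: "\<gamma> \<in> S" unfolding \<gamma>_def by (rule endo_mult_S[OF S_endo[OF S(1)] \<theta>(1)])
  have \<gamma>a: "\<gamma> a = \<theta> (\<alpha> a)" if "a \<in> A" for a using that by (simp add: \<gamma>_def endo_mult_apply)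
  have "same_kernel A \<alpha> \<gamma>"
    unfolding same_kernel_def using \<gamma>a inv' by metis
  then have "(\<alpha>, \<gamma>) \<in> Rs" by (rule Rs_same_kernel_AI[OF S(1) \<gamma>])
  moreover have "\<gamma> ` A = \<beta> ` A"
  proof -
    have "\<gamma> ` A = \<theta> ` \<alpha> ` A" using \<gamma>a by (auto simp: image_iff)
    also have "\<dots> = gen F (\<theta> ` Y)" using endo_gen[OF S_endo[OF \<theta>(1)] YA(1)] y(3) by simp
    also have "\<theta> ` Y = Y'" using \<theta>Y h by (auto simp: bij_betw_def image_iff)
    finally show ?thesis using y'(3) by simp
  qed
  then have "(\<gamma>, \<beta>) \<in> Ls" by (rule Ls_image_eq[OF \<gamma> S(2)])
  ultimately show ?thesis by blast
qed

text \<open>The map fixes \<open>X0\<close>, sends the rest of \<open>X\<close> to \<open>d\<close>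
  and spreads \<open>Z\<close> over \<open>W\<close>. Its values on \<open>B\<close> stay in the
  closure of \<open>X0\<close>, which misses \<open>W\<close>, and they do not depend on
  \<open>W\<close>. A target \<open>d\<close> exists only if \<open>X0\<close> generates something,
  which takes one element when there are no constants: this is where e enters.\<close>

lemma collapsing_map:
  assumes X: "basis_of F B X" "X \<inter> Z = {}" "basis_of F A (X \<union> Z)"
    and X0: "X0 \<subseteq> X" "d \<in> gen F X0"
    and W: "W \<subseteq> X - X0" "W \<noteq> {}" "|W| \<le>o |Z|"
  obtains \<gamma> where "\<gamma> \<in> S" "\<And>x. x \<in> X \<Longrightarrow> \<gamma> x = (if x \<in> X0 then x else d)"
    "\<gamma> ` A = gen F (X0 \<union> W)" "\<gamma> ` B \<noteq> \<gamma> ` A"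
proof -
  have XB: "X \<subseteq> B" using basis_of_subset[OF X(1)] .
  have XZ: "X \<union> Z \<subseteq> A" using basis_of_subset[OF X(3)] .
  have dB: "d \<in> B" using X0 gen_mono[OF X0(1), of F] basis_of_gen[OF X(1)] by auto
  \<comment> \<open>The cardinal inequality yields a surjection because \<open>W\<close> is
    non-empty.\<close>
  obtain h where h: "h ` Z = W" using card_of_ordLeq2[of W Z] W(2,3) by blast
  define g where "g x = (if x \<in> X0 then x else if x \<in> X then d else h x)" for x
  have hB: "h z \<in> B" if "z \<in> Z" for z using imageI[OF that, of h] W(1) XB unfolding h by blast
  have gB: "g x \<in> B" if "x \<in> X \<union> Z" for x using that XB X0(1) dB hB by (auto simp: g_def)
  obtain \<gamma> where \<gamma>: "\<gamma> \<in> S" "\<And>x. x \<in> X \<union> Z \<Longrightarrow> \<gamma> x = g x" using extend_map[OF X(3), of g, OF gB] by blast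
  have \<gamma>X: "\<gamma> x = (if x \<in> X0 then x else d)" if "x \<in> X" for x using that \<gamma>(2)[of x] by (simp add: g_def)
  have \<gamma>Z: "\<gamma> x = h x" if "x \<in> Z" for x using that \<gamma>(2)[of x] X(2) X0(1) by (auto simp: g_def)
  have sup: "X0 \<subseteq> \<gamma> ` X" using \<gamma>X X0(1) by force
  have sub: "\<gamma> ` X \<subseteq> gen F X0" using \<gamma>X X0(2) gen_superset[of X0 F] by auto
  have imZ: "\<gamma> ` Z = W" using \<gamma>Z h by (auto simp: image_iff)
  have "\<gamma> ` A = gen F (\<gamma> ` (X \<union> Z))"
    using endo_gen[OF S_endo[OF \<gamma>(1)] XZ] basis_of_gen[OF X(3)] by simp
  also have "\<dots> = gen F (X0 \<union> W)"
  proof (rule gen_eqI)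
    show "\<gamma> ` (X \<union> Z) \<subseteq> gen F (X0 \<union> W)"
      using sub imZ gen_mono[of X0 "X0 \<union> W" F] gen_superset[of "X0 \<union> W" F] by auto
    show "X0 \<union> W \<subseteq> gen F (\<gamma> ` (X \<union> Z))"
      using sup imZ gen_superset[of "\<gamma> ` (X \<union> Z)" F] by auto
  qed
  finally have imA: "\<gamma> ` A = gen F (X0 \<union> W)" .
  have "\<gamma> ` B = gen F (\<gamma> ` X)"
    using endo_gen[OF S_endo[OF \<gamma>(1)], of X] XZ basis_of_gen[OF X(1)] by simp
  also have "\<dots> \<subseteq> gen F X0" using sub by (rule gen_least)
  finally have imB: "\<gamma> ` B \<subseteq> gen F X0" .
  obtain w where w: "w \<in> W" using W(2) by blast
  have "X0 \<subseteq> X - {w}" using w W(1) X0(1) by auto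
  then have "w \<notin> gen F X0"
    using w W(1) X(1) gen_mono[of X0 "X - {w}" F] by (auto simp: basis_of_def independent_set_def)
  moreover have "w \<in> \<gamma> ` A" using w imA gen_superset[of "X0 \<union> W" F] by auto
  ultimately have "\<gamma> ` B \<noteq> \<gamma> ` A" using imB by blast
  then show thesis using that[of \<gamma>] \<gamma>(1) \<gamma>X imA by blast
qed

text \<open>Two collapsing maps with the same \<open>X0\<close> and \<open>d\<close> agree on
  \<open>B\<close>, so they are related by \<open>Rs\<close>. With surplus \<open>Y - X0\<close> the
  image is that of \<alpha>, which gives the \<open>Ls\<close> step; the surplus \<open>W'\<close>
  then changes the rank.\<close>

lemma collapsing_link:
  assumes \<alpha>: "\<alpha> \<in> S" and Y: "basis_of F (\<alpha> ` A) Y" and X0: "X0 \<subseteq> Y" "gen F X0 \<noteq> {}"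
    and W: "Y - X0 \<noteq> {}" "|Y - X0| \<le>o cd" and W': "W' \<subseteq> Y - X0" "W' \<noteq> {}" "|W'| \<le>o cd"
  shows "\<exists>\<gamma>\<in>S. basis_of F (\<gamma> ` A) (X0 \<union> W') \<and> (\<alpha>, \<gamma>) \<in> Ls O Rs"
proof -
  note y = image_indep[OF \<alpha> Y]
  obtain X where X: "Y \<subseteq> X" "basis_of F B X" using basis_extend[OF subalgebra_B y(1,2)] .
  obtain Z where Z: "X \<inter> Z = {}" "basis_of F A (X \<union> Z)" using complement_exists[OF subalgebra_B X(2)] .
  have cd: "cd =o |Z|" by (rule alg_codim_complement[OF subalgebra_B X(2) Z])
  obtain d where d: "d \<in> gen F X0" using X0(2) by blast
  have 0: "X0 \<subseteq> X" "Y - X0 \<subseteq> X - X0" "W' \<subseteq> X - X0" using X(1) X0(1) W'(1) by auto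
  have le: "|Y - X0| \<le>o |Z|" "|W'| \<le>o |Z|" using W(2) W'(3) ordLeq_cong_right[OF cd] by blast+
  obtain \<gamma> where \<gamma>: "\<gamma> \<in> S" "\<And>x. x \<in> X \<Longrightarrow> \<gamma> x = (if x \<in> X0 then x else d)"
    "\<gamma> ` A = gen F (X0 \<union> (Y - X0))" "\<gamma> ` B \<noteq> \<gamma> ` A"
    using collapsing_map[OF X(2) Z 0(1) d 0(2) W(1) le(1)] by blast
  obtain \<gamma>' where \<gamma>': "\<gamma>' \<in> S" "\<And>x. x \<in> X \<Longrightarrow> \<gamma>' x = (if x \<in> X0 then x else d)"
    "\<gamma>' ` A = gen F (X0 \<union> W')" "\<gamma>' ` B \<noteq> \<gamma>' ` A"
    using collapsing_map[OF X(2) Z 0(1) d 0(3) W'(2) le(2)] by blast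
  have XA: "X \<subseteq> A" using basis_of_subset[OF Z(2)] by simp
  have "\<gamma> b = \<gamma>' b" if "b \<in> B" for b
    using endo_eq_on_gen[OF S_endo[OF \<gamma>(1)] S_endo[OF \<gamma>'(1)] XA] \<gamma>(2) \<gamma>'(2) that basis_of_gen[OF X(2)] by simp
  then have "same_kernel B \<gamma> \<gamma>'" by (simp add: same_kernel_def)
  then have "(\<gamma>, \<gamma>') \<in> Rs" by (rule Rs_same_kernel_BI[OF \<gamma>(1) \<gamma>'(1) _ \<gamma>(4) \<gamma>'(4)])
  moreover have "X0 \<union> (Y - X0) = Y" using X0(1) by auto
  then have "(\<alpha>, \<gamma>) \<in> Ls" using \<gamma>(3) y(3) by (intro Ls_image_eq[OF \<alpha> \<gamma>(1)]) simp
  moreover have "basis_of F (\<gamma>' ` A) (X0 \<union> W')"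
  proof -
    have "X0 \<union> W' \<subseteq> Y" using X0(1) W'(1) by auto
    then have "gen.indep (X0 \<union> W')" by (rule gen.indep_subset[OF y(1)])
    then show ?thesis
      unfolding basis_of_iff[OF endo_image_carrier[OF S_endo[OF \<gamma>'(1)] subset_refl]]
      using \<gamma>'(3) gen_superset[of "X0 \<union> W'" F] by simp
  qed
  ultimately show ?thesis using \<gamma>'(1) by blast
qed

section \<open>Lowering ranks to e + 1\<close>

lemma mid_basis_iff:
  assumes "\<alpha> \<in> S" "basis_of F (\<alpha> ` A) Y" "cd =o |Z|"
  shows "mid \<alpha> \<longleftrightarrow> (if finite Z then 2 \<le> card Z \<and> finite Y \<and> const_defect F < card Y
    else |Y| \<le>o |Z| \<and> (infinite Y \<or> const_defect F < card Y))"
  using mid_rank_card_of[OF assms(3) alg_rank_basis[OF S_endo[OF assms(1)] assms(2)]] .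

text \<open>Each step replaces a surplus of two elements by one of them and so lowers the rank by
  one. A surplus of two is all that codimension at least 2 guarantees, hence the induction on the
  excess over e + 1.\<close>

lemma reduce_finite_codim:
  assumes Z: "cd =o |Z|" "2 \<le> card Z"
    and r: "equiv S r" "Ls \<subseteq> r" "Rs \<subseteq> r"
    and \<alpha>: "\<alpha> \<in> S" "basis_of F (\<alpha> ` A) Y" "finite Y" "card Y = Suc (const_defect F) + n"
  shows "\<exists>\<gamma>\<in>S. rk \<gamma> =o fin_card (Suc (const_defect F)) \<and> (\<alpha>, \<gamma>) \<in> r"
  using \<alpha>
proof (induction n arbitrary: \<alpha> Y)
  case 0
  have "rk \<alpha> =o |Y|" using 0 alg_rank_basis S_endo by blast
  moreover have "|Y| =o fin_card (Suc (const_defect F))" using 0 by (simp add: card_of_ordIso_fin_card)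
  ultimately have "rk \<alpha> =o fin_card (Suc (const_defect F))" by (rule ordIso_transitive)
  moreover have "(\<alpha>, \<alpha>) \<in> r" using r(1) 0 by (auto simp: equiv_def refl_on_def)
  ultimately show ?case using 0 by blast
next
  case (Suc n)
  have "2 \<le> card Y" using Suc.prems(4) by simp
  then obtain T where "T \<subseteq> Y" "card T = 2" by (rule obtain_subset_with_card_n)
  then obtain w w' where w: "w \<in> Y" "w' \<in> Y" "w \<noteq> w'" by (auto simp: card_2_iff)
  define X0 where "X0 = Y - {w, w'}"
  have W: "Y - X0 = {w, w'}" using w by (auto simp: X0_def)
  \<comment> \<open>At least e elements remain, so the collapsed part has a target.\<close>
  have cX: "card X0 = const_defect F + n" using Suc.prems w by (simp add: X0_def card_Diff_subset)
  have finZ: "finite Z" using Z(2) card.infinite by fastforce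
  have le: "|{w, w'}| \<le>o cd" "|{w}| \<le>o cd"
    using Z(2) w(3) finZ finite_card_of_ordLeq[of "{w, w'}" Z] finite_card_of_ordLeq[of "{w}" Z]
    by (simp_all add: ordLeq_cong_right[OF Z(1)])
  have "\<exists>\<gamma>\<in>S. basis_of F (\<gamma> ` A) (X0 \<union> {w}) \<and> (\<alpha>, \<gamma>) \<in> Ls O Rs"
  proof (rule collapsing_link[OF Suc.prems(1,2)])
    show "X0 \<subseteq> Y" by (auto simp: X0_def)
    show "gen F X0 \<noteq> {}" using cX by (intro gen_nonempty) simp
  qed (use W le in auto)
  then obtain \<gamma> where \<gamma>: "\<gamma> \<in> S" "basis_of F (\<gamma> ` A) (X0 \<union> {w})" "(\<alpha>, \<gamma>) \<in> Ls O Rs" by blast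
  have "card (X0 \<union> {w}) = Suc (const_defect F) + n" using cX Suc.prems(3) by (simp add: X0_def)
  then obtain \<delta> where \<delta>: "\<delta> \<in> S" "rk \<delta> =o fin_card (Suc (const_defect F))" "(\<gamma>, \<delta>) \<in> r"
    using Suc.IH[OF \<gamma>(1,2)] Suc.prems(3) by (auto simp: X0_def)
  have "(\<alpha>, \<delta>) \<in> r" using \<gamma>(3) r(2,3) \<delta>(3) r(1) unfolding equiv_def trans_def by blast
  with \<delta> show ?case by blast
qed

text \<open>With e elements kept fixed, all the rest of \<open>Y\<close> is no larger than the
  complement of \<open>B\<close>, so a single link replaces it by one element.\<close>

lemma reduce_infinite_codim:
  assumes Z: "cd =o |Z|" "infinite Z"
    and r: "equiv S r" "Ls \<subseteq> r" "Rs \<subseteq> r"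
    and \<alpha>: "\<alpha> \<in> S" "basis_of F (\<alpha> ` A) Y" "|Y| \<le>o |Z|" "infinite Y \<or> const_defect F < card Y"
  shows "\<exists>\<gamma>\<in>S. rk \<gamma> =o fin_card (Suc (const_defect F)) \<and> (\<alpha>, \<gamma>) \<in> r"
proof -
  have "\<exists>V\<subseteq>Y. finite V \<and> card V = Suc (const_defect F)"
  proof (cases "finite Y")
    case True
    with \<alpha>(4) have "Suc (const_defect F) \<le> card Y" by simp
    then show ?thesis by (rule obtain_subset_with_card_n) blast
  next
    case False
    from infinite_arbitrarily_large[OF this] show ?thesis by blast
  qed
  then obtain V where V: "V \<subseteq> Y" "finite V" "card V = Suc (const_defect F)" by blast
  then obtain w where w: "w \<in> V" by fastforce
  define X0 where "X0 = V - {w}"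
  have cX: "card X0 = const_defect F" using V w by (simp add: X0_def)
  have Vw: "X0 \<union> {w} = V" using w by (auto simp: X0_def)
  have "\<exists>\<gamma>\<in>S. basis_of F (\<gamma> ` A) (X0 \<union> {w}) \<and> (\<alpha>, \<gamma>) \<in> Ls O Rs"
  proof (rule collapsing_link[OF \<alpha>(1,2)])
    show "X0 \<subseteq> Y" using V by (auto simp: X0_def)
    show "gen F X0 \<noteq> {}" using cX by (intro gen_nonempty) simp
    show "|Y - X0| \<le>o cd"
      unfolding ordLeq_cong_right[OF Z(1)] by (rule ordLeq_transitive[OF card_of_mono1 \<alpha>(3)]) auto
    show "|{w}| \<le>o cd"
      unfolding ordLeq_cong_right[OF Z(1)]
      using finite_ordLess_infinite_card_of[of "{w}" Z] Z(2) ordLess_imp_ordLeq by blast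
    show "Y - X0 \<noteq> {}" "{w} \<subseteq> Y - X0" using V w by (auto simp: X0_def)
  qed auto
  then obtain \<gamma> where \<gamma>: "\<gamma> \<in> S" "basis_of F (\<gamma> ` A) (X0 \<union> {w})" "(\<alpha>, \<gamma>) \<in> Ls O Rs" by blast
  have "rk \<gamma> =o |V|" using alg_rank_basis[OF S_endo[OF \<gamma>(1)] \<gamma>(2)] Vw by simp
  moreover have "|V| =o fin_card (Suc (const_defect F))" using V by (simp add: card_of_ordIso_fin_card)
  ultimately have "rk \<gamma> =o fin_card (Suc (const_defect F))" by (rule ordIso_transitive)
  moreover have "(\<alpha>, \<gamma>) \<in> r" using \<gamma>(3) r unfolding equiv_def trans_def by blast
  ultimately show ?thesis using \<gamma>(1) by blast
qed

lemma mid_reduce: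
  assumes \<alpha>: "\<alpha> \<in> S" "mid \<alpha>" and r: "equiv S r" "Ls \<subseteq> r" "Rs \<subseteq> r"
  shows "\<exists>\<gamma>\<in>S. rk \<gamma> =o fin_card (Suc (const_defect F)) \<and> (\<alpha>, \<gamma>) \<in> r"
proof -
  obtain Y where Y: "basis_of F (\<alpha> ` A) Y" using image_basis_exists[OF \<alpha>(1)] .
  obtain X where X: "basis_of F B X" using basis_exists[OF subalgebra_B] .
  obtain Z where Z: "X \<inter> Z = {}" "basis_of F A (X \<union> Z)" using complement_exists[OF subalgebra_B X] .
  have cd: "cd =o |Z|" by (rule alg_codim_complement[OF subalgebra_B X Z])
  note mid = mid_basis_iff[OF \<alpha>(1) Y cd]
  show ?thesis
  proof (cases "finite Z")
    case True
    then have "2 \<le> card Z" "finite Y" "const_defect F < card Y" using \<alpha>(2) mid by auto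
    moreover from this have "card Y = Suc (const_defect F) + (card Y - Suc (const_defect F))" by simp
    ultimately show ?thesis using reduce_finite_codim[OF cd _ r \<alpha>(1) Y] by blast
  next
    case False
    then show ?thesis using \<alpha>(2) mid reduce_infinite_codim[OF cd False r \<alpha>(1) Y] by auto
  qed
qed

text \<open>Serves the transitivity of the relation in \<open>D_star_iff\<close>, where equality of
  ranks and the range condition can alternate.\<close>

lemma mid_cong:
  assumes "rk \<alpha> =o rk \<beta>"
  shows "mid \<alpha> \<longleftrightarrow> mid \<beta>"
proof -
  have "rk \<alpha> \<le>o cd \<longleftrightarrow> rk \<beta> \<le>o cd"
    using assms by (meson ordIso_ordLeq_trans ordIso_symmetric)
  then show ?thesis
    unfolding mid_rank_def ordLess_cong_right[OF assms] ordLess_cong_left[OF assms] by simp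
qed

text \<open>From left to right, the right-hand side is an equivalence containing \<open>Ls\<close>
  and \<open>Rs\<close>. From right to left, the chain is built inside an arbitrary such
  equivalence; two ranks of the range meet at maps of the common rank e + 1.\<close>

lemma D_star_iff:
  assumes S: "\<alpha> \<in> S" "\<beta> \<in> S"
  shows "(\<alpha>, \<beta>) \<in> D_star S (endo_mult A) \<longleftrightarrow> rk \<alpha> =o rk \<beta> \<or> mid \<alpha> \<and> mid \<beta>"
proof
  let ?r = "{(\<alpha>, \<beta>) \<in> S \<times> S. rk \<alpha> =o rk \<beta> \<or> mid \<alpha> \<and> mid \<beta>}"
  assume D: "(\<alpha>, \<beta>) \<in> D_star S (endo_mult A)"
  have "equiv S ?r"
  proof (rule equivI)
    show "?r \<subseteq> S \<times> S" by auto
    show "refl_on S ?r" by (auto simp: refl_on_def alg_rank_def alg_dim_def card_of_refl)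
    show "sym ?r" by (auto simp: sym_def intro: ordIso_symmetric)
    show "trans ?r"
    proof (rule transI)
      fix \<alpha> \<beta> \<gamma> assume "(\<alpha>, \<beta>) \<in> ?r" "(\<beta>, \<gamma>) \<in> ?r"
      then show "(\<alpha>, \<gamma>) \<in> ?r"
        using ordIso_transitive[of "rk \<alpha>" "rk \<beta>" "rk \<gamma>"] mid_cong[of \<alpha> \<beta>] mid_cong[of \<beta> \<gamma>] by blast
    qed
  qed
  moreover have "Ls \<union> Rs \<subseteq> ?r"
  proof (rule subrelI)
    fix \<gamma> \<delta> assume *: "(\<gamma>, \<delta>) \<in> Ls \<union> Rs"
    then have "rk \<gamma> =o rk \<delta> \<or> mid \<gamma> \<and> mid \<delta>" using Ls_rank_eq Rs_rank by blast
    with * show "(\<gamma>, \<delta>) \<in> ?r" by (auto simp: L_star_def R_star_def)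
  qed
  ultimately have "(\<alpha>, \<beta>) \<in> ?r" using D unfolding D_star_def by blast
  then show "rk \<alpha> =o rk \<beta> \<or> mid \<alpha> \<and> mid \<beta>" by blast
next
  assume *: "rk \<alpha> =o rk \<beta> \<or> mid \<alpha> \<and> mid \<beta>"
  have "(\<alpha>, \<beta>) \<in> r" if r: "equiv S r" "Ls \<union> Rs \<subseteq> r" for r
  proof -
    have sub: "Ls \<subseteq> r" "Rs \<subseteq> r" and tr: "\<And>x y z. (x, y) \<in> r \<Longrightarrow> (y, z) \<in> r \<Longrightarrow> (x, z) \<in> r"
      and sy: "\<And>x y. (x, y) \<in> r \<Longrightarrow> (y, x) \<in> r"
      using r unfolding equiv_def trans_def sym_def by blast+
    have eq: "(\<gamma>, \<delta>) \<in> r" if "\<gamma> \<in> S" "\<delta> \<in> S" "rk \<gamma> =o rk \<delta>" for \<gamma> \<delta>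
      using equal_rank_link[OF that] sub tr by blast
    show ?thesis using *
    proof
      assume "rk \<alpha> =o rk \<beta>"
      then show ?thesis using eq S by blast
    next
      assume m: "mid \<alpha> \<and> mid \<beta>"
      then obtain \<gamma> where \<gamma>: "\<gamma> \<in> S" "rk \<gamma> =o fin_card (Suc (const_defect F))" "(\<alpha>, \<gamma>) \<in> r"
        using mid_reduce[OF S(1) _ r(1) sub] by blast
      from m obtain \<delta> where \<delta>: "\<delta> \<in> S" "rk \<delta> =o fin_card (Suc (const_defect F))" "(\<beta>, \<delta>) \<in> r"
        using mid_reduce[OF S(2) _ r(1) sub] by blast
      have "rk \<gamma> =o rk \<delta>" using \<gamma>(2) \<delta>(2) by (meson ordIso_symmetric ordIso_transitive)
      then have "(\<gamma>, \<delta>) \<in> r" by (rule eq[OF \<gamma>(1) \<delta>(1)])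
      then show ?thesis using \<gamma>(3) \<delta>(3) tr sy by blast
    qed
  qed
  then show "(\<alpha>, \<beta>) \<in> D_star S (endo_mult A)" unfolding D_star_def by blast
qed

end

theorem theorem6p13:
  fixes A B :: "'a set" and F :: "'a operation set" and \<alpha> \<beta> :: "'a \<Rightarrow> 'a"
  assumes "independence_algebra A F"
    and "subalgebra A F B" and "B \<noteq> {}" and "B \<noteq> A"
    and "fin_card 2 \<le>o alg_dim F B \<or> (gen F {} \<noteq> {} \<and> alg_dim F B =o fin_card 1)"
    and "\<alpha> \<in> restr_range_endos A F B" and "\<beta> \<in> restr_range_endos A F B"
  shows "(\<alpha>, \<beta>) \<in> D_star (restr_range_endos A F B) (endo_mult A) \<longleftrightarrow>
      (alg_codim A F B =o fin_card 1 \<and> alg_rank A F \<alpha> =o alg_rank A F \<beta>) \<or>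
      (fin_card 2 \<le>o alg_codim A F B \<and> alg_codim A F B <o natLeq \<and>
        ((fin_card (const_defect F) <o alg_rank A F \<alpha> \<and> alg_rank A F \<alpha> <o natLeq \<and>
          fin_card (const_defect F) <o alg_rank A F \<beta> \<and> alg_rank A F \<beta> <o natLeq) \<or>
         alg_rank A F \<alpha> =o alg_rank A F \<beta>)) \<or>
      (natLeq \<le>o alg_codim A F B \<and>
        ((fin_card (const_defect F) <o alg_rank A F \<alpha> \<and> alg_rank A F \<alpha> \<le>o alg_codim A F B \<and>
          fin_card (const_defect F) <o alg_rank A F \<beta> \<and> alg_rank A F \<beta> \<le>o alg_codim A F B) \<or>
         alg_rank A F \<alpha> =o alg_rank A F \<beta>))"
proof -
  interpret independence_algebra A F by (rule assms(1))
  interpret restricted_range A F B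
    by unfold_locales (use assms(2-4) two_elements[OF assms(2,5)] in auto)
  obtain X where X: "basis_of F B X" using basis_exists[OF subalgebra_B] .
  obtain Z where Z: "X \<inter> Z = {}" "basis_of F A (X \<union> Z)" using complement_exists[OF subalgebra_B X] .
  show ?thesis
    unfolding D_star_iff[OF assms(6,7)]
    by (rule classification_iff[symmetric, OF alg_codim_complement[OF subalgebra_B X Z]
          complement_nonempty[OF X Z(2)]])
qed

end
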